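(* Let $n\ge 1$ and let $w\in A_n^\dagger$ be a timed word. Suppose that its insertion tableau $P(w)$ has shape $\lambda=(\lambda_1,\dots,\lambda_l)$. Then the Greene invariants of $w$ are given by $$a_r(w)=\lambda_1+\dots+\lambda_r\quad\text{for } r=1,\dots,l.$$
   Context: **Timed words.** Let $A_n=\{1,\dots,n\}$ with its usual order. A timed word in $A_n$ is a finite (possibly empty) sequence $w=c_1^{t_1}c_2^{t_2}\cdots c_k^{t_k}$ with $c_i\in A_n$, $t_i$ positive real numbers, and $c_i\ne c_{i+1}$ for $1\le i\le k-1$. A sequence in which $c_i=c_{i+1}$ for some $i$ also represents a timed word: segments $c^{t}c^{t'}$ are replaced by $c^{t+t'}$ until consecutive letters differ. The empty timed word is denoted $\emptyset$. The length of $w$ is $l(w)=t_1+\dots+t_k$. The function associated to $w$ is the piecewise constant function $\mathbf w:[0,l(w))\to A_n$ given by $\mathbf w(t)=c_i$ if $t_1+\dots+t_{i-1}\le t<t_1+\dots+t_i$; it determines $w$. The set of timed words in $A_n$ is a monoid under concatenation, denoted $A_n^\dagger$. A timed word $c_1^{t_1}\cdots c_k^{t_k}$ (with consecutive letters distinct) is a timed row if $c_1<\dots<c_k$. For $0\le a\le b\le l(w)$, $w_{[a,b)}$ is the timed word of length $b-a$ with associated function $t\mapsto \mathbf w(a+t)$, $0\le t<b-a$ (empty if $a=b$). **Subwords.** A time sample of $w$ is a subset of $[0,l(w))$ of the form $S=[a_1,b_1)\cup\dots\cup[a_k,b_k)$ with $0\le a_1<b_1<a_2<b_2<\dots<a_k<b_k\le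 l(w)$ ($k=0$, the empty set, is allowed). Let $\mu$ be Lebesgue measure. The subword $w_S$ of $w$ with respect to $S$ is the timed word of length $\mu(S)$ with associated function $\mathbf w_S(t)=\mathbf w(b_t)$ for $0\le t<\mu(S)$, where $b_t$ is the largest number in $[0,l(w))$ such that $\mu(S\cap[0,b_t))=t$. **Greene invariants.** For an integer $r\ge1$, $a_r(w)$ is the supremum of $\mu(S_1)+\dots+\mu(S_r)$ over all $r$-tuples $S_1,\dots,S_r$ of pairwise disjoint time samples of $w$ such that $w_{S_i}$ is a timed row for each $i$. **Timed tableaux.** A timed tableau is a finite sequence $u_1,\dots,u_l$ of timed words (its rows) such that each $u_i$ is a timed row, $l(u_i)\ge l(u_{i+1})$ for $1\le i\le l-1$, and $\mathbf u_i(t)<\mathbf u_{i+1}(t)$ for $1\le i\le l-1$ and $0\le t<l(u_{i+1})$. Its shape is $(l(u_1),\dots,l(u_l))$, where the rows listed are the nonempty ones. **Row insertion.** For a timed row $w$, a letter $c\in A_n$ and a real $t_c>0$, define $\mathrm{RINS}(w,c^{t_c})$ as follows. If $\mathbf w(t)\le c$ for all $0\le t<l(w)$, then $\mathrm{RINS}(w,c^{t_c})=(\emptyset,wc^{t_c})$. Otherwise let $t_0=\min\{0\le t<l(w)\mid \mathbf w(t)>c\}$ and set $$\mathrm{RINS}(w,c^{t_c})=\begin{cases}(w_{[t_0,t_0+t_c)},\ w_{[0,t_0)}\,c^{t_c}\,w_{[t_0+t_c,l(w))}) & \text{if } l(w)-t_0>t_c,\\ (w_{[t_0,l(w))},\ w_{[0,t_0)}\,c^{t_c})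 & \text{if } l(w)-t_0\le t_c.\end{cases}$$ For a timed word $u=c_1^{t_1}\cdots c_m^{t_m}$ define $\mathrm{RINS}(w,u)$ by induction on $m$: $\mathrm{RINS}(w,\emptyset)=(\emptyset,w)$, and if $(v',w')=\mathrm{RINS}(w,c_1^{t_1}\cdots c_{m-1}^{t_{m-1}})$ and $(v'',w'')=\mathrm{RINS}(w',c_m^{t_m})$, then $\mathrm{RINS}(w,u)=(v'v'',w'')$. **Tableau insertion.** Let $T$ be a timed tableau with rows $u_1,\dots,u_l$ and let $v$ be a timed row. Put $v_0'=v$ and, successively for $i=1,\dots,l$, $(v_i',u_i')=\mathrm{RINS}(u_i,v_{i-1}')$. Then $\mathrm{INSERT}(T,v)$ is the timed tableau with rows $u_1',\dots,u_l',v_l'$, where the last row $v_l'$ is omitted if it is empty. **Insertion tableau.** $P(\emptyset)=\emptyset$ (the tableau with no rows), and $P(wc^t)=\mathrm{INSERT}(P(w),c^t)$; that is, for $w=c_1^{t_1}\cdots c_k^{t_k}$, one inserts $c_1^{t_1},\dots,c_k^{t_k}$ successively into the empty tableau. *)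

theory Defs
  imports "HOL-Analysis.Analysis"
begin

text \<open>
  A timed word with segments \<open>c\<^sub>i\<close> of durations \<open>t\<^sub>i\<close> is represented by the list of its segments \<open>(c\<^sub>i, t\<^sub>i)\<close>.
  Every timed word has exactly one reduced representative, and all operations below
  return reduced representatives when applied to such.
\<close>

type_synonym tword = "(nat \<times> real) list"

definition reduced :: "tword \<Rightarrow> bool" where
  "reduced w \<longleftrightarrow> (\<forall>(c, t) \<in> set w. 0 < t) \<and> distinct_adj (map fst w)"

definition timed_words :: "nat \<Rightarrow> tword set" where
  "timed_words n = {w. reduced w \<and> fst ` set w \<subseteq> {1..n}}"

fun reduce :: "tword \<Rightarrow> tword" where
  "reduce [] = []"
| "reduce [x] = [x]"
| "reduce ((c, s) # (d, t) # w) =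
     (if c = d then reduce ((c, s + t) # w) else (c, s) # reduce ((d, t) # w))"

definition tconc :: "tword \<Rightarrow> tword \<Rightarrow> tword" where
  "tconc u v = reduce (u @ v)"

definition tlen :: "tword \<Rightarrow> real" where
  "tlen w = sum_list (map snd w)"

text \<open>The function associated to a word; it is meaningful only on \<open>[0, tlen w)\<close>.\<close>

fun letter_at :: "tword \<Rightarrow> real \<Rightarrow> nat" where
  "letter_at [] x = undefined"
| "letter_at ((c, t) # w) x = (if x < t then c else letter_at w (x - t))"

definition timed_row :: "tword \<Rightarrow> bool" where
  "timed_row w \<longleftrightarrow> reduced w \<and> sorted_wrt (<) (map fst w)"

text \<open>The timed word with prescribed length and associated function.\<close>

definition tword_of :: "real \<Rightarrow> (real \<Rightarrow> nat) \<Rightarrow> tword" where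
  "tword_of L f = (THE v. reduced v \<and> tlen v = L \<and> (\<forall>t. 0 \<le> t \<and> t < L \<longrightarrow> letter_at v t = f t))"

definition segment :: "tword \<Rightarrow> real \<Rightarrow> real \<Rightarrow> tword" where
  "segment w a b = tword_of (b - a) (\<lambda>t. letter_at w (a + t))"

text \<open>
  The list \<open>ps\<close> contains the pairs \<open>(a\<^sub>i, b\<^sub>i)\<close>; flattening it expresses the chain
  \<open>a\<^sub>1 < b\<^sub>1 < a\<^sub>2 < b\<^sub>2 < \<dots>\<close> of strict inequalities.
\<close>

definition time_sample :: "tword \<Rightarrow> real set \<Rightarrow> bool" where
  "time_sample w S \<longleftrightarrow>
     (\<exists>ps. sorted_wrt (<) (concat (map (\<lambda>(a, b). [a, b]) ps)) \<and>
           (\<forall>(a, b) \<in> set ps. 0 \<le> a \<and> b \<le> tlen w) \<and>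
           S = (\<Union>(a, b) \<in> set ps. {a..<b}))"

definition subword :: "tword \<Rightarrow> real set \<Rightarrow> tword" where
  "subword w S = tword_of (measure lebesgue S)
     (\<lambda>t. letter_at w (GREATEST b. 0 \<le> b \<and> b < tlen w \<and> measure lebesgue (S \<inter> {0..<b}) = t))"

text \<open>The supremum is over a nonempty set of reals bounded above by \<open>tlen w\<close>.\<close>

definition greene :: "nat \<Rightarrow> tword \<Rightarrow> real" where
  "greene r w = Sup {(\<Sum>i = 1..r. measure lebesgue (S i)) | S :: nat \<Rightarrow> real set.
     (\<forall>i \<in> {1..r}. time_sample w (S i) \<and> timed_row (subword w (S i))) \<and>
     disjoint_family_on S {1..r}}"

definition rins_letter :: "tword \<Rightarrow> nat \<times> real \<Rightarrow> tword \<times> tword" where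
  "rins_letter w = (\<lambda>(c, s).
     if \<forall>t. 0 \<le> t \<and> t < tlen w \<longrightarrow> letter_at w t \<le> c then ([], tconc w [(c, s)])
     else let t\<^sub>0 = (LEAST t. 0 \<le> t \<and> t < tlen w \<and> c < letter_at w t) in
       if s < tlen w - t\<^sub>0
       then (segment w t\<^sub>0 (t\<^sub>0 + s),
             tconc (tconc (segment w 0 t\<^sub>0) [(c, s)]) (segment w (t\<^sub>0 + s) (tlen w)))
       else (segment w t\<^sub>0 (tlen w), tconc (segment w 0 t\<^sub>0) [(c, s)]))"

definition rins :: "tword \<Rightarrow> tword \<Rightarrow> tword \<times> tword" where
  "rins w u =
     foldl (\<lambda>(v', w') x. let (v'', w'') = rins_letter w' x in (tconc v' v'', w'')) ([], w) u"

text \<open>A tableau is the list of its rows, starting with the first one.\<close>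

fun tab_insert :: "tword list \<Rightarrow> tword \<Rightarrow> tword list" where
  "tab_insert [] v = (if v = [] then [] else [v])"
| "tab_insert (u # us) v = (let (v', u') = rins u v in u' # tab_insert us v')"

definition insertion_tableau :: "tword \<Rightarrow> tword list" where
  "insertion_tableau w = foldl (\<lambda>T x. tab_insert T [x]) [] w"

definition tab_shape :: "tword list \<Rightarrow> real list" where
  "tab_shape T = map tlen (filter (\<lambda>u. u \<noteq> []) T)"

end

theory Submission imports Defs begin

text \<open>
  Since a row may always use the whole of a segment of which it uses a part, a family of \<open>r\<close>
  disjoint time samples with row subwords amounts to a colouring of some of the segments of \<open>w\<close>
  with \<open>r\<close> colours such that the letters of each colour increase weakly; its total measure is
  at most the total duration of the coloured segments, with equality for a suitable choice of
  samples. So \<open>greene r w\<close> is the largest weight of such a colouring (\<open>samples_attain\<close>,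
  \<open>attains_samples\<close>), and Greene's theorem becomes a statement about sequences of weighted
  letters.

  Two words are called Knuth equivalent here if, inside any context, their colourings have
  the same maximal weight. The moves \<open>a z\<^sup>s y\<^sup>s \<leftrightarrow> z\<^sup>s a y\<^sup>s\<close> (for a row \<open>a\<close> with letters at most \<open>y\<close>, and
  \<open>y < z\<close>) and \<open>y\<^sup>s b x\<^sup>s \<leftrightarrow> y\<^sup>s x\<^sup>s b\<close> (for a row \<open>b\<close> with letters at least \<open>y\<close>, and \<open>x < y\<close>)
  preserve this equivalence: an increasing sequence that the move destroys is repaired by
  exchanging the two segments of equal duration \<open>s\<close>, together with the tails (or heads) of the
  two colours involved (\<open>knuth_block_left\<close>, \<open>knuth_block_right\<close>). Row insertion is a composition
  of such moves (\<open>knuth_eq_bump\<close>), hence \<open>w\<close> is equivalent to the reading word of its insertion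
  tableau, the concatenation of the rows from bottom to top (\<open>insertion_tableau_knuth_eq\<close>).

  For the reading word of a tableau, the first \<open>r\<close> rows give a colouring of weight
  \<open>\<lambda>\<^sub>1 + \<dots> + \<lambda>\<^sub>r\<close>. It is optimal because every colour meets the column at a given time at most once
  (\<open>attains_reading_le\<close>). This needs that insertion preserves column strictness, which is
  derived from inequalities between the durations \<open>below u d\<close> of the letters smaller than \<open>d\<close> in
  the rows (\<open>rins_row\<close>, \<open>above_rins\<close>).
\<close>

section \<open>Timed words and their functions\<close>

lemma tlen_simps [simp]: "tlen [] = 0" "tlen (x # w) = snd x + tlen w" "tlen (u @ v) = tlen u + tlen v"
  by (auto simp: tlen_def)

text \<open>A list of segments with nonnegative durations; it need not be reduced.\<close>

definition nonneg :: "tword \<Rightarrow> bool" where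
  "nonneg w \<longleftrightarrow> (\<forall>x \<in> set w. 0 \<le> snd x)"

text \<open>A list of segments with positive durations.\<close>

definition pos :: "tword \<Rightarrow> bool" where
  "pos w \<longleftrightarrow> (\<forall>x \<in> set w. 0 < snd x)"

lemma nonneg_simps [simp]: "nonneg []" "nonneg (x # w) \<longleftrightarrow> 0 \<le> snd x \<and> nonneg w"
  "nonneg (u @ v) \<longleftrightarrow> nonneg u \<and> nonneg v"
  by (auto simp: nonneg_def)

lemma pos_simps [simp]: "pos []" "pos (x # w) \<longleftrightarrow> 0 < snd x \<and> pos w"
  "pos (u @ v) \<longleftrightarrow> pos u \<and> pos v"
  by (auto simp: pos_def)

lemma pos_nonneg: "pos w \<Longrightarrow> nonneg w"
  by (auto simp: pos_def nonneg_def intro: less_imp_le)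

lemma nonneg_take: "nonneg w \<Longrightarrow> nonneg (take n w)"
  by (auto simp: nonneg_def dest: in_set_takeD)

lemma tlen_nonneg: "nonneg w \<Longrightarrow> 0 \<le> tlen w"
  by (induction w) auto

lemma tlen_pos: "pos w \<Longrightarrow> w \<noteq> [] \<Longrightarrow> 0 < tlen w"
  by (cases w) (auto simp: add_pos_nonneg tlen_nonneg pos_nonneg)

lemma letter_at_append:
  "nonneg u \<Longrightarrow> 0 \<le> x \<Longrightarrow> letter_at (u @ v) x = (if x < tlen u then letter_at u x else letter_at v (x - tlen u))"
proof (induction u arbitrary: x)
  case (Cons p u)
  then show ?case using tlen_nonneg[of u] by (cases p) (auto simp: algebra_simps)
qed simp

lemma letter_at_in: "nonneg w \<Longrightarrow> 0 \<le> x \<Longrightarrow> x < tlen w \<Longrightarrow> letter_at w x \<in> fst ` set w"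
proof (induction w arbitrary: x)
  case (Cons p w)
  then show ?case by (cases p) (auto simp: algebra_simps)
qed simp

lemma letter_at_nth:
  assumes "nonneg w" "j < length w" "tlen (take j w) \<le> x" "x < tlen (take (Suc j) w)"
  shows "letter_at w x = fst (w ! j)"
  using assms
proof (induction w arbitrary: j x)
  case (Cons p w)
  show ?case
  proof (cases j)
    case 0
    then show ?thesis using Cons.prems by (cases p) auto
  next
    case (Suc i)
    have "0 \<le> tlen (take i w)" using Cons.prems by (simp add: tlen_nonneg nonneg_take)
    moreover have "letter_at w (x - snd p) = fst (w ! i)"
      using Cons.prems Suc by (intro Cons.IH) auto
    ultimately show ?thesis using Cons.prems Suc by (cases p) auto
  qed
qed simp

lemma tlen_take_mono: "nonneg w \<Longrightarrow> i \<le> j \<Longrightarrow> tlen (take i w) \<le> tlen (take j w)"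
proof -
  assume "nonneg w" "i \<le> j"
  then have "take j w = take i w @ take (j - i) (drop i w)" by (metis le_add_diff_inverse take_add)
  moreover have "nonneg (take (j - i) (drop i w))"
    using \<open>nonneg w\<close> by (auto simp: nonneg_def dest!: in_set_takeD in_set_dropD)
  ultimately show ?thesis using tlen_nonneg by simp
qed

lemma tlen_take_Suc: "j < length w \<Longrightarrow> tlen (take (Suc j) w) = tlen (take j w) + snd (w ! j)"
  by (simp add: take_Suc_conv_app_nth)

lemma obtain_segment:
  assumes "nonneg w" "0 \<le> x" "x < tlen w"
  obtains j where "j < length w" "tlen (take j w) \<le> x" "x < tlen (take (Suc j) w)"
proof -
  have "\<exists>j < length w. tlen (take j w) \<le> x \<and> x < tlen (take (Suc j) w)"
    using assms
  proof (induction w rule: rev_induct)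
    case (snoc p w)
    show ?case
    proof (cases "x < tlen w")
      case True
      then obtain j where "j < length w" "tlen (take j w) \<le> x" "x < tlen (take (Suc j) w)"
        using snoc by auto
      then show ?thesis by (intro exI[of _ j]) auto
    next
      case False
      then show ?thesis using snoc.prems by (intro exI[of _ "length w"]) auto
    qed
  qed simp
  then show ?thesis using that by blast
qed

section \<open>Reduced words\<close>

lemma tlen_reduce [simp]: "tlen (reduce w) = tlen w"
  by (induction w rule: reduce.induct) auto

lemma pos_reduce: "pos w \<Longrightarrow> pos (reduce w)"
  by (induction w rule: reduce.induct) auto

lemma letters_reduce [simp]: "fst ` set (reduce w) = fst ` set w"
  by (induction w rule: reduce.induct) auto

lemma letter_at_reduce: "nonneg w \<Longrightarrow> letter_at (reduce w) x = letter_at w x"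
  by (induction w arbitrary: x rule: reduce.induct) (auto simp: algebra_simps)

lemma reduce_eq_Nil [simp]: "reduce w = [] \<longleftrightarrow> w = []"
  by (metis image_is_empty letters_reduce set_empty)

lemma hd_reduce: "w \<noteq> [] \<Longrightarrow> fst (hd (reduce w)) = fst (hd w)"
  by (induction w rule: reduce.induct) auto

lemma distinct_adj_reduce: "distinct_adj (map fst (reduce w))"
proof (induction w rule: reduce.induct)
  case (3 c s d t w)
  show ?case
  proof (cases "c = d")
    case False
    obtain p v where *: "reduce ((d, t) # w) = p # v" by (metis list.exhaust list.distinct(1) reduce_eq_Nil)
    have "fst p = d" using hd_reduce[of "(d, t) # w"] * by simp
    then show ?thesis using 3 False * by auto
  qed (use 3 in auto)
qed auto

lemma reduced_iff: "reduced w \<longleftrightarrow> pos w \<and> distinct_adj (map fst w)"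
  by (auto simp: reduced_def pos_def)

lemma reduced_reduce: "pos w \<Longrightarrow> reduced (reduce w)"
  by (simp add: reduced_iff pos_reduce distinct_adj_reduce)

lemma reduce_id: "reduced w \<Longrightarrow> reduce w = w"
  by (induction w rule: reduce.induct) (auto simp: reduced_iff)

text \<open>A timed word is determined by its length and its function.\<close>

lemma reduced_eqI:
  assumes "reduced v" "reduced w" "tlen v = tlen w"
    and "\<And>t. 0 \<le> t \<Longrightarrow> t < tlen v \<Longrightarrow> letter_at v t = letter_at w t"
  shows "v = w"
  using assms
proof (induction v arbitrary: w)
  case Nil
  then show ?case using tlen_pos[of w] by (auto simp: reduced_iff)
next
  case (Cons p v)
  have pw: "pos w" "pos v" "0 < snd p" using Cons.prems by (auto simp: reduced_iff)
  have "0 < tlen w" using Cons.prems(3) pw tlen_nonneg[of v] by (auto simp: pos_nonneg)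
  then obtain q u where w: "w = q # u" by (cases w) auto
  obtain c s where p: "p = (c, s)" by (cases p)
  obtain d t where q: "q = (d, t)" by (cases q)
  have st: "0 < s" "0 < t" using pw w p q by auto
  have len: "s + tlen v = t + tlen u" using Cons.prems w p q by auto
  have tv: "0 \<le> tlen v" "0 \<le> tlen u" using pw w by (auto simp: tlen_nonneg pos_nonneg)
  have f: "letter_at ((c, s) # v) x = letter_at ((d, t) # u) x" if "0 \<le> x" "x < s + tlen v" for x
    using Cons.prems(4)[of x] that w p q by simp
  have cd: "c = d" using f[of 0] st tv by simp
  have ne: "v \<noteq> [] \<Longrightarrow> fst (hd v) \<noteq> c" "u \<noteq> [] \<Longrightarrow> fst (hd u) \<noteq> d"
    using Cons.prems(1,2) w p q by (auto simp: reduced_iff distinct_adj_Cons hd_map)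
  have hd0: "letter_at x 0 = fst (hd x)" if "pos x" "x \<noteq> []" for x
    using that by (cases x; cases "hd x") auto
  have "s = t"
  proof (rule ccontr)
    assume "s \<noteq> t"
    then consider "s < t" | "t < s" by linarith
    then show False
    proof cases
      case 1
      then have "v \<noteq> []" using len tv by auto
      then show False using f[of s] 1 ne hd0[of v] pw cd st len tv tlen_pos[of v] by auto
    next
      case 2
      then have "u \<noteq> []" using len tv by auto
      then show False using f[of t] 2 ne hd0[of u] pw w cd st len tv tlen_pos[of u] by auto
    qed
  qed
  moreover have "v = u"
  proof (rule Cons.IH)
    show "reduced v" "reduced u" using Cons.prems(1,2) w by (auto simp: reduced_iff distinct_adj_Cons)
    show "tlen v = tlen u" using len \<open>s = t\<close> by simp
    fix x assume "0 \<le> x" "x < tlen v"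
    then show "letter_at v x = letter_at u x" using f[of "x + s"] \<open>s = t\<close> st by simp
  qed
  ultimately show ?case using w p q cd by simp
qed

lemma tword_of_eqI:
  assumes "reduced v" "tlen v = L" "\<And>t. 0 \<le> t \<Longrightarrow> t < L \<Longrightarrow> letter_at v t = f t"
  shows "tword_of L f = v"
  unfolding tword_of_def using assms by (intro the_equality) (auto intro!: reduced_eqI)

lemma timed_row_iff: "timed_row w \<longleftrightarrow> pos w \<and> sorted_wrt (<) (map fst w)"
proof -
  have "sorted_wrt (<) xs \<Longrightarrow> distinct_adj xs" for xs :: "nat list"
    by (induction xs) (auto simp: distinct_adj_Cons)
  then show ?thesis by (auto simp: timed_row_def reduced_iff)
qed

lemma sorted_reduce_iff: "pos w \<Longrightarrow> sorted (map fst (reduce w)) \<longleftrightarrow> sorted (map fst w)"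
  by (induction w rule: reduce.induct) auto

text \<open>The reduced form of a word is a row exactly when its letters increase weakly.\<close>

lemma timed_row_reduce_iff:
  assumes "pos w" shows "timed_row (reduce w) \<longleftrightarrow> sorted (map fst w)"
proof -
  have "sorted_wrt (<) xs \<longleftrightarrow> sorted xs" if "distinct_adj xs" for xs :: "nat list"
    using that by (induction xs rule: induct_list012) auto
  then show ?thesis
    using assms sorted_reduce_iff[OF assms] distinct_adj_reduce[of w] by (auto simp: timed_row_iff pos_reduce)
qed

section \<open>Colourings and Knuth equivalence\<close>

text \<open>
  A colouring of a word is given by the list of its segments, each paired with a colour. Colour 0
  means that the segment is not used; the segments of any other colour have to form a weakly
  increasing word.
\<close>

type_synonym cword = "((nat \<times> real) \<times> nat) list"

text \<open>The relation required between a coloured segment and a later one.\<close>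

definition compat :: "(nat \<times> real) \<times> nat \<Rightarrow> (nat \<times> real) \<times> nat \<Rightarrow> bool" where
  "compat x y \<longleftrightarrow> (snd x = snd y \<longrightarrow> snd x \<noteq> 0 \<longrightarrow> fst (fst x) \<le> fst (fst y))"

definition colouring :: "nat \<Rightarrow> tword \<Rightarrow> cword \<Rightarrow> bool" where
  "colouring r w X \<longleftrightarrow> map fst X = w \<and> (\<forall>x \<in> set X. snd x \<le> r) \<and> sorted_wrt compat X"

text \<open>The total duration of the coloured segments.\<close>

definition cweight :: "cword \<Rightarrow> real" where
  "cweight X = (\<Sum>x \<leftarrow> X. if snd x = 0 then 0 else snd (fst x))"

definition attains :: "nat \<Rightarrow> tword \<Rightarrow> real \<Rightarrow> bool" where
  "attains r w m \<longleftrightarrow> (\<exists>X. colouring r w X \<and> m \<le> cweight X)"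

text \<open>In every context, \<open>u\<close> admits colourings of at least the weights that \<open>v\<close> admits.\<close>

definition dominates :: "tword \<Rightarrow> tword \<Rightarrow> bool" where
  "dominates u v \<longleftrightarrow> (\<forall>r p q m. attains r (p @ v @ q) m \<longrightarrow> attains r (p @ u @ q) m)"

text \<open>
  Knuth equivalence is defined by the property that matters here, the equality of all weighted
  Greene invariants in every context, rather than being generated by elementary moves.
\<close>

definition knuth_eq :: "tword \<Rightarrow> tword \<Rightarrow> bool" (infix "\<approx>\<^sub>K" 50) where
  "u \<approx>\<^sub>K v \<longleftrightarrow> dominates u v \<and> dominates v u"

lemma cweight_simps [simp]: "cweight [] = 0"
  "cweight (x # X) = (if snd x = 0 then 0 else snd (fst x)) + cweight X"
  "cweight (X @ Y) = cweight X + cweight Y"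
  by (auto simp: cweight_def)

lemma knuth_eq_refl [simp]: "u \<approx>\<^sub>K u"
  by (auto simp: knuth_eq_def dominates_def)

lemma knuth_eq_sym: "u \<approx>\<^sub>K v \<Longrightarrow> v \<approx>\<^sub>K u"
  by (auto simp: knuth_eq_def)

lemma knuth_eq_trans [trans]: "u \<approx>\<^sub>K v \<Longrightarrow> v \<approx>\<^sub>K w \<Longrightarrow> u \<approx>\<^sub>K w"
  unfolding knuth_eq_def dominates_def by meson

lemma dominates_context: "dominates u v \<Longrightarrow> dominates (p @ u @ q) (p @ v @ q)"
  unfolding dominates_def
proof (intro allI impI)
  fix r p' q' m
  assume "\<forall>r p q m. attains r (p @ v @ q) m \<longrightarrow> attains r (p @ u @ q) m"
    and "attains r (p' @ (p @ v @ q) @ q') m"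
  then show "attains r (p' @ (p @ u @ q) @ q') m"
    by (elim allE[of _ r] allE[of _ "p' @ p"] allE[of _ "q @ q'"] allE[of _ m]) simp
qed

lemma knuth_eq_context: "u \<approx>\<^sub>K v \<Longrightarrow> p @ u @ q \<approx>\<^sub>K p @ v @ q"
  using dominates_context by (simp add: knuth_eq_def)

lemma dominatesD: "dominates u v \<Longrightarrow> attains r (p @ v @ q) m \<Longrightarrow> attains r (p @ u @ q) m"
  by (auto simp: dominates_def)

lemma knuth_eq_attains: "u \<approx>\<^sub>K v \<Longrightarrow> attains r u m \<longleftrightarrow> attains r v m"
  using dominatesD[of u v r "[]" "[]"] dominatesD[of v u r "[]" "[]"] by (auto simp: knuth_eq_def)

lemma map_eq_appendE:
  assumes "map f X = p @ u @ q"
  obtains P U Q where "X = P @ U @ Q" "map f P = p" "map f U = u" "map f Q = q"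
proof
  show "X = take (length p) X @ take (length u) (drop (length p) X) @ drop (length u) (drop (length p) X)"
    by (simp only: append_take_drop_id)
  show "map f (take (length p) X) = p" "map f (take (length u) (drop (length p) X)) = u"
    "map f (drop (length u) (drop (length p) X)) = q"
    by (simp_all only: take_map[symmetric] drop_map[symmetric] assms) simp_all
qed

text \<open>
  Domination is always shown by changing a given colouring locally. The colours of what
  follows may have to be permuted.
\<close>

lemma dominatesI:
  assumes "\<And>r P U Q. colouring r (map fst P @ u @ map fst Q) (P @ U @ Q) \<Longrightarrow> map fst U = u \<Longrightarrow>
    \<exists>V Q'. map fst Q' = map fst Q \<and> colouring r (map fst P @ v @ map fst Q) (P @ V @ Q') \<and>
       cweight U + cweight Q \<le> cweight V + cweight Q'"
  shows "dominates v u"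
  unfolding dominates_def
proof (intro allI impI)
  fix r p q m
  assume "attains r (p @ u @ q) m"
  then obtain X where X: "colouring r (p @ u @ q) X" "m \<le> cweight X" by (auto simp: attains_def)
  from X(1) have "map fst X = p @ u @ q" by (simp add: colouring_def)
  then obtain P U Q where "X = P @ U @ Q" "map fst P = p" "map fst U = u" "map fst Q = q"
    by (elim map_eq_appendE)
  then obtain V Q' where "colouring r (p @ v @ q) (P @ V @ Q')" 
       "cweight U + cweight Q \<le> cweight V + cweight Q'" using assms[of r P Q U] X by auto
  then show "attains r (p @ v @ q) m"
    using X \<open>X = P @ U @ Q\<close> unfolding attains_def
    by (intro exI[of _ "P @ V @ Q'"]) auto
qed

lemma zero_segment: "[(c, 0)] \<approx>\<^sub>K []"
  unfolding knuth_eq_def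
proof
  show "dominates [] [(c, 0)]"
  proof (rule dominatesI)
    fix r P U Q assume "colouring r (map fst P @ [(c, 0)] @ map fst Q) (P @ U @ Q)" "map fst U = [(c, 0)]"
    then show "\<exists>V Q'. map fst Q' = map fst Q \<and> colouring r (map fst P @ [] @ map fst Q) (P @ V @ Q') \<and>
       cweight U + cweight Q \<le> cweight V + cweight Q'"
      by (intro exI[of _ "[]"] exI[of _ Q]) (auto simp: colouring_def sorted_wrt_append)
  qed
  show "dominates [(c, 0)] []"
  proof (rule dominatesI)
    fix r P U Q assume "colouring r (map fst P @ [] @ map fst Q) (P @ U @ Q)" "map fst U = []"
    then show "\<exists>V Q'. map fst Q' = map fst Q \<and> colouring r (map fst P @ [(c, 0)] @ map fst Q) (P @ V @ Q') \<and>
       cweight U + cweight Q \<le> cweight V + cweight Q'"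
      by (intro exI[of _ "[((c,0),0)]"] exI[of _ Q])
        (auto simp: colouring_def sorted_wrt_append compat_def)
  qed
qed

lemma split_segment:
  assumes "0 \<le> s" "0 \<le> t"
  shows "[(c, s + t)] \<approx>\<^sub>K [(c, s), (c, t)]"
  unfolding knuth_eq_def
proof
  show "dominates [(c, s), (c, t)] [(c, s + t)]"
  proof (rule dominatesI)
    fix r P U Q assume *: "colouring r (map fst P @ [(c, s + t)] @ map fst Q) (P @ U @ Q)" 
      "map fst U = [(c, s + t)]"
    then obtain k where "U = [((c, s + t), k)]" by auto
    with * show "\<exists>V Q'. map fst Q' = map fst Q \<and>
       colouring r (map fst P @ [(c, s), (c, t)] @ map fst Q) (P @ V @ Q') \<and>
       cweight U + cweight Q \<le> cweight V + cweight Q'"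
      by (intro exI[of _ "[((c, s), k), ((c, t), k)]"] exI[of _ Q])
        (auto simp: colouring_def sorted_wrt_append compat_def)
  qed
  show "dominates [(c, s + t)] [(c, s), (c, t)]"
  proof (rule dominatesI)
    fix r P U Q assume *: "colouring r (map fst P @ [(c, s), (c, t)] @ map fst Q) (P @ U @ Q)" 
      "map fst U = [(c, s), (c, t)]"
    then obtain k l where "U = [((c, s), k), ((c, t), l)]" by auto
    with * assms show "\<exists>V Q'. map fst Q' = map fst Q \<and>
       colouring r (map fst P @ [(c, s + t)] @ map fst Q) (P @ V @ Q') \<and>
       cweight U + cweight Q \<le> cweight V + cweight Q'"
      by (intro exI[of _ "[((c, s + t), if k = 0 then l else k)]"] exI[of _ Q])
        (auto simp: colouring_def sorted_wrt_append compat_def)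
  qed
qed

text \<open>Changing the colours by a map.\<close>

definition recolour :: "(nat \<Rightarrow> nat) \<Rightarrow> cword \<Rightarrow> cword" where
  "recolour f = map (apsnd f)"

lemma map_fst_recolour [simp]: "map fst (recolour f X) = map fst X"
  by (simp add: recolour_def comp_def)

lemma cweight_recolour:
  "(\<And>x. x \<in> set X \<Longrightarrow> f (snd x) = 0 \<longleftrightarrow> snd x = 0) \<Longrightarrow> cweight (recolour f X) = cweight X"
  by (induction X) (auto simp: recolour_def)

lemma set_recolour: "set (recolour f X) = apsnd f ` set X"
  by (simp add: recolour_def)

lemma sorted_wrt_recolour:
  assumes "sorted_wrt compat X" "inj_on f (insert 0 (snd ` set X))" "f 0 = 0"
  shows "sorted_wrt compat (recolour f X)"
  unfolding recolour_def sorted_wrt_map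
proof (rule sorted_wrt_mono_rel[OF _ assms(1)])
  fix x y assume "x \<in> set X" "y \<in> set X" "compat x y"
  moreover have "f (snd x) = f (snd y) \<Longrightarrow> snd x = snd y"
    using \<open>x \<in> set X\<close> \<open>y \<in> set X\<close> by (auto intro: inj_onD[OF assms(2)])
  moreover have "f (snd x) \<noteq> 0 \<Longrightarrow> snd x \<noteq> 0" using assms(3) by metis
  ultimately show "compat (apsnd f x) (apsnd f y)"
    unfolding compat_def by auto
qed

lemma sorted_wrt_recolour_sorted:
  assumes "sorted (map (fst \<circ> fst) X)" shows "sorted_wrt compat (recolour f X)"
proof -
  have "sorted_wrt (\<lambda>x y. fst (fst x) \<le> fst (fst y)) X" using assms by (simp add: sorted_wrt_map)
  then have "sorted_wrt (\<lambda>x y. compat (apsnd f x) (apsnd f y)) X"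
    by (rule sorted_wrt_mono_rel[rotated]) (simp add: compat_def)
  then show ?thesis by (simp add: recolour_def sorted_wrt_map)
qed

text \<open>The letters of the segments that have a given colour.\<close>

definition lets :: "nat \<Rightarrow> cword \<Rightarrow> nat set" where
  "lets k X = {c. \<exists>t. ((c, t), k) \<in> set X}"

text \<open>
  No segment of \<open>X\<close> obstructs a segment of \<open>Y\<close> of the same colour, when \<open>X\<close> precedes \<open>Y\<close>.
\<close>

definition before :: "cword \<Rightarrow> cword \<Rightarrow> bool" where
  "before X Y \<longleftrightarrow> (\<forall>k a b. k \<noteq> 0 \<longrightarrow> a \<in> lets k X \<longrightarrow> b \<in> lets k Y \<longrightarrow> a \<le> b)"

lemma beforeI: "(\<And>k a b. k \<noteq> 0 \<Longrightarrow> a \<in> lets k X \<Longrightarrow> b \<in> lets k Y \<Longrightarrow> a \<le> b) \<Longrightarrow> before X Y"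
  by (simp add: before_def)

lemma before_casesI:
  assumes "\<And>a b. i \<noteq> 0 \<Longrightarrow> a \<in> lets i X \<Longrightarrow> b \<in> lets i Y \<Longrightarrow> a \<le> b"
    and "\<And>a b. j \<noteq> 0 \<Longrightarrow> a \<in> lets j X \<Longrightarrow> b \<in> lets j Y \<Longrightarrow> a \<le> b"
    and "\<And>k a b. k \<noteq> 0 \<Longrightarrow> k \<noteq> i \<Longrightarrow> k \<noteq> j \<Longrightarrow> a \<in> lets k X \<Longrightarrow> b \<in> lets k Y \<Longrightarrow> a \<le> b"
  shows "before X Y"
proof (rule beforeI)
  fix k a b assume "k \<noteq> 0" "a \<in> lets k X" "b \<in> lets k Y"
  then show "a \<le> b" using assms by (cases "k = i"; cases "k = j") auto
qed

lemma beforeD: "before X Y \<Longrightarrow> k \<noteq> 0 \<Longrightarrow> a \<in> lets k X \<Longrightarrow> b \<in> lets k Y \<Longrightarrow> a \<le> b"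
  by (simp add: before_def)

lemma lets_simps [simp]: "lets k [] = {}" "lets k (X @ Y) = lets k X \<union> lets k Y"
  "lets k [((c, t), l)] = (if k = l then {c} else {})"
  by (auto simp: lets_def)

lemma lets_recolour: "lets k (recolour f X) = (\<Union>l \<in> {l. f l = k}. lets l X)"
  by (force simp: lets_def set_recolour)

lemma before_append [simp]: "before (X @ Y) Z \<longleftrightarrow> before X Z \<and> before Y Z"
  "before X (Y @ Z) \<longleftrightarrow> before X Y \<and> before X Z"
  by (auto simp: before_def)

lemma sorted_wrt_compat_append:
  "sorted_wrt compat (X @ Y) \<longleftrightarrow> sorted_wrt compat X \<and> sorted_wrt compat Y \<and> before X Y"
proof -
  have "(\<forall>x\<in>set X. \<forall>y\<in>set Y. compat x y) \<longleftrightarrow> before X Y"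
  proof
    assume *: "\<forall>x\<in>set X. \<forall>y\<in>set Y. compat x y"
    show "before X Y"
    proof (rule beforeI)
      fix k a b assume "k \<noteq> 0" "a \<in> lets k X" "b \<in> lets k Y"
      then obtain s t where "((a, s), k) \<in> set X" "((b, t), k) \<in> set Y" by (auto simp: lets_def)
      then have "compat ((a, s), k) ((b, t), k)" using * by blast
      then show "a \<le> b" using \<open>k \<noteq> 0\<close> by (simp add: compat_def)
    qed
  next
    assume *: "before X Y"
    show "\<forall>x\<in>set X. \<forall>y\<in>set Y. compat x y"
    proof (intro ballI)
      fix x y assume "x \<in> set X" "y \<in> set Y"
      then have "fst (fst x) \<in> lets (snd x) X" "fst (fst y) \<in> lets (snd y) Y"
        unfolding lets_def by (metis (mono_tags, lifting) mem_Collect_eq prod.collapse)+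
      then show "compat x y" using beforeD[OF *, of "snd x"] unfolding compat_def by metis
    qed
  qed
  then show ?thesis by (simp add: sorted_wrt_append)
qed

lemma before_single [simp]:
  "before X [((c, t), k)] \<longleftrightarrow> k = 0 \<or> (\<forall>a \<in> lets k X. a \<le> c)"
  "before [((c, t), k)] X \<longleftrightarrow> k = 0 \<or> (\<forall>a \<in> lets k X. c \<le> a)"
  by (auto simp: before_def)

text \<open>Both elementary moves rearrange three consecutive blocks and possibly recolour what follows.\<close>

lemma colouring_blocksI:
  assumes "map fst V1 = v1" "map fst V2 = v2" "map fst V3 = v3" "map fst Q = q"
    and "\<forall>x \<in> set P. snd x \<le> r" "\<forall>x \<in> set V1. snd x \<le> r" "\<forall>x \<in> set V2. snd x \<le> r"
      "\<forall>x \<in> set V3. snd x \<le> r" "\<forall>x \<in> set Q. snd x \<le> r"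
    and "sorted_wrt compat P" "sorted_wrt compat V1" "sorted_wrt compat V2" "sorted_wrt compat V3"
      "sorted_wrt compat Q"
    and "before P V1" "before P V2" "before P V3" "before P Q" "before V1 V2" "before V1 V3"
      "before V1 Q" "before V2 V3" "before V2 Q" "before V3 Q"
  shows "colouring r (map fst P @ (v1 @ v2 @ v3) @ q) (P @ (V1 @ V2 @ V3) @ Q)"
  unfolding colouring_def sorted_wrt_compat_append before_append set_append map_append ball_Un
  using assms by simp

lemma colouring_blocksD:
  assumes "colouring r w (P @ (V1 @ V2 @ V3) @ Q)"
  shows "\<forall>x \<in> set P. snd x \<le> r" "\<forall>x \<in> set V1. snd x \<le> r" "\<forall>x \<in> set V2. snd x \<le> r"
      "\<forall>x \<in> set V3. snd x \<le> r" "\<forall>x \<in> set Q. snd x \<le> r"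
    "sorted_wrt compat P" "sorted_wrt compat V1" "sorted_wrt compat V2" "sorted_wrt compat V3"
      "sorted_wrt compat Q"
    "before P V1" "before P V2" "before P V3" "before P Q" "before V1 V2" "before V1 V3"
      "before V1 Q" "before V2 V3" "before V2 Q" "before V3 Q"
  using assms
  unfolding colouring_def sorted_wrt_compat_append before_append set_append map_append ball_Un
  by simp_all

lemma lets_letters: "a \<in> lets k X \<Longrightarrow> a \<in> fst ` set (map fst X)"
  unfolding lets_def by force

lemma recolour_le:
  "\<forall>x \<in> set X. snd x \<le> r \<Longrightarrow> (\<And>k. k \<le> r \<Longrightarrow> f k \<le> r) \<Longrightarrow> \<forall>x \<in> set (recolour f X). snd x \<le> r"
  by (auto simp: set_recolour)

lemma lets_merge [simp]: "i \<noteq> j \<Longrightarrow> lets k (recolour (\<lambda>k. if k = j then i else k) X) =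
    (if k = i then lets i X \<union> lets j X else if k = j then {} else lets k X)"
  by (auto simp: lets_recolour split: if_splits)

lemma lets_swap [simp]:
  "lets k (recolour (\<lambda>k. if k = i then j else if k = j then i else k) X) =
    (if k = i then lets j X else if k = j then lets i X else lets k X)"
  by (auto simp: lets_recolour split: if_splits)

lemma map_fst_single: "map fst X = [x] \<Longrightarrow> \<exists>k. X = [(x, k)]"
  by (cases X) auto

text \<open>
  Only a colour \<open>i\<close> that uses both \<open>z\<^sup>s\<close> and some segment of \<open>a\<close> has to be changed. If \<open>y\<^sup>s\<close> is not
  coloured, it replaces \<open>z\<^sup>s\<close>. Otherwise let \<open>j\<close> be the colour of \<open>y\<^sup>s\<close>. As \<open>a\<close> is increasing, the
  segments of \<open>a\<close> of the colours \<open>i\<close> and \<open>j\<close> form a single increasing sequence, which can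
  continue that one of the two initial parts that ends in the smaller letter, and be continued
  by \<open>y\<^sup>s\<close>; the other initial part is continued by \<open>z\<^sup>s\<close>.
\<close>

lemma knuth_block_left_dom:
  assumes a: "sorted (map fst a)" "\<And>x. x \<in> set a \<Longrightarrow> fst x \<le> y" and yz: "y < z"
  shows "dominates ([(z, s)] @ a @ [(y, s)]) (a @ [(z, s)] @ [(y, s)])"
proof (rule dominatesI)
  fix r P U Q
  assume col: "colouring r (map fst P @ (a @ [(z, s)] @ [(y, s)]) @ map fst Q) (P @ U @ Q)"
    and "map fst U = a @ [(z, s)] @ [(y, s)]"
  from this(2) obtain A Z Y where "U = A @ Z @ Y" "map fst A = a" "map fst Z = [(z, s)]" "map fst Y = [(y, s)]"
    by (rule map_eq_appendE)
  moreover obtain i where "Z = [((z, s), i)]" using map_fst_single[OF calculation(3)] by blast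
  moreover obtain j where "Y = [((y, s), j)]" using map_fst_single[OF calculation(4)] by blast
  ultimately have U: "U = A @ [((z, s), i)] @ [((y, s), j)]" "map fst A = a" by simp_all
  have A: "sorted (map (fst \<circ> fst) A)" using a(1) unfolding U(2)[symmetric] by simp
  have Ay: "x \<le> y" if "x \<in> lets k A" for x k
    using lets_letters[OF that] a(2) U(2) by auto
  note c = colouring_blocksD[OF col[unfolded U(1)]]
  have le: "i \<le> r" "j \<le> r" using c(3,4) by simp_all
  have ij: "i \<noteq> j \<or> j = 0" using c(18) yz by auto
  have PA: "b \<le> x" if "k \<noteq> 0" "b \<in> lets k P" "x \<in> lets k A" for k b x
    using beforeD[OF c(11) that] .
  have AQ: "b \<le> x" if "k \<noteq> 0" "b \<in> lets k A" "x \<in> lets k Q" for k b x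
    using beforeD[OF c(17) that] .
  have PQ: "b \<le> x" if "k \<noteq> 0" "b \<in> lets k P" "x \<in> lets k Q" for k b x
    using beforeD[OF c(14) that] .
  have Py: "b \<le> y" if "j \<noteq> 0" "b \<in> lets j P" for b using c(13) that by simp
  have zQ: "z \<le> b" if "i \<noteq> 0" "b \<in> lets i Q" for b using c(19) that by simp
  have yQ: "y \<le> b" if "j \<noteq> 0" "b \<in> lets j Q" for b using c(20) that by simp
  show "\<exists>V Q'. map fst Q' = map fst Q \<and>
      colouring r (map fst P @ ([(z, s)] @ a @ [(y, s)]) @ map fst Q) (P @ V @ Q') \<and>
      cweight U + cweight Q \<le> cweight V + cweight Q'" (is "\<exists>V Q'. ?good V Q'")
  proof -
    consider (free) "i = 0 \<or> lets i A = {}"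
      | (unused) x where "i \<noteq> 0" "x \<in> lets i A" "j = 0"
      | (both) x where "i \<noteq> 0" "x \<in> lets i A" "j \<noteq> 0" by blast
    then show ?thesis
    proof cases
      case free
      have "before [((z, s), i)] A" "before [((z, s), i)] [((y, s), j)]" "before A [((y, s), j)]"
        using free ij Ay by auto
      then have "colouring r (map fst P @ ([(z, s)] @ a @ [(y, s)]) @ map fst Q)
         (P @ ([((z, s), i)] @ A @ [((y, s), j)]) @ Q)"
        by (intro colouring_blocksI c) (simp_all only: U list.map fst_conv)
      then have "?good ([((z, s), i)] @ A @ [((y, s), j)]) Q" using U(1) by simp
      then show ?thesis by blast
    next
      case unused
      have n1: "before P [((y, s), i)]"
        using le_trans[OF PA[of i _ x] Ay[of x i]] unused by simp
      have n2: "before [((y, s), i)] Q" using zQ unused yz by fastforce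
      have n3: "before [((z, s), 0)] A" "before [((z, s), 0)] [((y, s), i)]" "before A [((y, s), i)]"
        "before P [((z, s), 0)]" "before [((z, s), 0)] Q"
        using unused ij Ay by auto
      have "colouring r (map fst P @ ([(z, s)] @ a @ [(y, s)]) @ map fst Q)
         (P @ ([((z, s), 0)] @ A @ [((y, s), i)]) @ Q)"
        by (intro colouring_blocksI c n1 n2 n3) (simp_all add: U(2) le)
      then have "?good ([((z, s), 0)] @ A @ [((y, s), i)]) Q" using U(1) unused by simp
      then show ?thesis by blast
    next
      case both
      then have "i \<noteq> j" using ij by simp
      have Pi: "b \<le> y" if "b \<in> lets i P" for b
        using le_trans[OF PA[of i b x] Ay[of x i]] that both by simp
      consider (1) "\<forall>b \<in> lets i P. \<forall>x \<in> lets j A. b \<le> x" | (2) "\<forall>b \<in> lets j P. \<forall>x \<in> lets i A. b \<le> x"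
      proof (cases "\<forall>b \<in> lets i P. \<forall>x \<in> lets j A. b \<le> x")
        case False
        then obtain b x where bx: "b \<in> lets i P" "x \<in> lets j A" "x < b" by (auto simp: not_le)
        have "b' \<le> x'" if "b' \<in> lets j P" "x' \<in> lets i A" for b' x'
          using PA[of j b' x] PA[of i b x'] bx both that by simp
        then show ?thesis using that by blast
      qed
      then show ?thesis
      proof cases
        case 1
        let ?A = "recolour (\<lambda>k. if k = j then i else k) A"
        let ?Q = "recolour (\<lambda>k. if k = i then j else if k = j then i else k) Q"
        have w: "cweight ?A = cweight A" "cweight ?Q = cweight Q"
          using both by (auto intro!: cweight_recolour split: if_split_asm)
        have n1: "before P ?A" using 1 PA both \<open>i \<noteq> j\<close> by (intro before_casesI[of i _ _ j]) auto
        have n2: "before P ?Q"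
          using le_trans[OF Pi yQ] le_trans[OF le_trans[OF Py less_imp_le[OF yz]] zQ] PQ both
          by (intro before_casesI[of i _ _ j]) (simp_all split: if_split_asm)
        have n3: "before ?A ?Q"
          using le_trans[OF Ay yQ] AQ both \<open>i \<noteq> j\<close> by (intro before_casesI[of i _ _ j]) auto
        have n4: "before P [((z, s), j)]" using le_trans[OF Py less_imp_le[OF yz]] both by simp
        have n5: "before P [((y, s), i)]" using Pi by simp
        have n6: "before [((z, s), j)] ?A" "before [((z, s), j)] [((y, s), i)]" "before ?A [((y, s), i)]"
          using Ay \<open>i \<noteq> j\<close> by auto
        have n7: "before [((z, s), j)] ?Q" using zQ both by simp
        have n8: "before [((y, s), i)] ?Q" using yQ both by simp
        have n9: "sorted_wrt compat ?A" using A by (rule sorted_wrt_recolour_sorted)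
        have n10: "sorted_wrt compat ?Q"
          using c(10) both by (intro sorted_wrt_recolour) (auto simp: inj_on_def)
        have n11: "\<forall>x \<in> set ?A. snd x \<le> r" "\<forall>x \<in> set ?Q. snd x \<le> r"
          using c(2-5) by (intro recolour_le; simp)+
        have "colouring r (map fst P @ ([(z, s)] @ a @ [(y, s)]) @ map fst Q)
            (P @ ([((z, s), j)] @ ?A @ [((y, s), i)]) @ ?Q)"
          by (intro colouring_blocksI c n1 n2 n3 n4 n5 n6 n7 n8 n9 n10 n11) (simp_all add: U(2) le)
        then have "?good ([((z, s), j)] @ ?A @ [((y, s), i)]) ?Q" using U(1) both w by simp
        then show ?thesis by blast
      next
        case 2
        let ?A = "recolour (\<lambda>k. if k = i then j else k) A"
        have w: "cweight ?A = cweight A"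
          using both by (auto intro!: cweight_recolour split: if_split_asm)
        have n1: "before P ?A" using 2 PA both \<open>i \<noteq> j\<close> by (intro before_casesI[of i _ _ j]) auto
        have n2: "before ?A Q"
          using le_trans[OF Ay yQ] AQ both \<open>i \<noteq> j\<close> by (intro before_casesI[of i _ _ j]) auto
        have n3: "before [((z, s), i)] ?A" "before [((z, s), i)] [((y, s), j)]" "before ?A [((y, s), j)]"
          using Ay \<open>i \<noteq> j\<close> by auto
        have n4: "sorted_wrt compat ?A" using A by (rule sorted_wrt_recolour_sorted)
        have n5: "\<forall>x \<in> set ?A. snd x \<le> r" using c(2-5) by (intro recolour_le; simp)+
        have "colouring r (map fst P @ ([(z, s)] @ a @ [(y, s)]) @ map fst Q)
            (P @ ([((z, s), i)] @ ?A @ [((y, s), j)]) @ Q)"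
          by (intro colouring_blocksI c n1 n2 n3 n4 n5) (simp_all add: U(2) le)
        then have "?good ([((z, s), i)] @ ?A @ [((y, s), j)]) Q" using U(1) both w by simp
        then show ?thesis by blast
      qed
    qed
  qed
qed

text \<open>
  The mirror image of the previous argument: the segments of \<open>b\<close> of the colours of \<open>x\<^sup>s\<close> and \<open>y\<^sup>s\<close>
  are all put behind \<open>y\<^sup>s\<close>, and are followed by that one of the two tails that starts with the
  larger letter.
\<close>

lemma knuth_block_right_dom:
  assumes b: "sorted (map fst b)" "\<And>v. v \<in> set b \<Longrightarrow> y \<le> fst v" and xy: "x < y"
  shows "dominates ([(y, s)] @ b @ [(x, s)]) ([(y, s)] @ [(x, s)] @ b)"
proof (rule dominatesI)
  fix r P U Q
  assume col: "colouring r (map fst P @ ([(y, s)] @ [(x, s)] @ b) @ map fst Q) (P @ U @ Q)"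
    and "map fst U = [(y, s)] @ [(x, s)] @ b"
  from this(2) obtain Y X B where "U = Y @ X @ B" "map fst Y = [(y, s)]" "map fst X = [(x, s)]" "map fst B = b"
    by (rule map_eq_appendE)
  moreover obtain i where "X = [((x, s), i)]" using map_fst_single[OF calculation(3)] by blast
  moreover obtain j where "Y = [((y, s), j)]" using map_fst_single[OF calculation(2)] by blast
  ultimately have U: "U = [((y, s), j)] @ [((x, s), i)] @ B" "map fst B = b" by simp_all
  have B: "sorted (map (fst \<circ> fst) B)" using b(1) unfolding U(2)[symmetric] by simp
  have By: "y \<le> v" if "v \<in> lets k B" for v k
    using lets_letters[OF that] b(2) U(2) by auto
  note c = colouring_blocksD[OF col[unfolded U(1)]]
  have le: "i \<le> r" "j \<le> r" using c(2,3) by simp_all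
  have ij: "i \<noteq> j \<or> j = 0" using c(15) xy by auto
  have BQ: "v \<le> u" if "k \<noteq> 0" "v \<in> lets k B" "u \<in> lets k Q" for k v u
    using beforeD[OF c(20) that] .
  have PB: "v \<le> u" if "k \<noteq> 0" "v \<in> lets k P" "u \<in> lets k B" for k v u
    using beforeD[OF c(13) that] .
  have PQ: "v \<le> u" if "k \<noteq> 0" "v \<in> lets k P" "u \<in> lets k Q" for k v u
    using beforeD[OF c(14) that] .
  have Px: "v \<le> x" if "i \<noteq> 0" "v \<in> lets i P" for v using c(12) that by simp
  have Py: "v \<le> y" if "j \<noteq> 0" "v \<in> lets j P" for v using c(11) that by simp
  have yQ: "y \<le> v" if "j \<noteq> 0" "v \<in> lets j Q" for v using c(17) that by simp
  show "\<exists>V Q'. map fst Q' = map fst Q \<and>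
      colouring r (map fst P @ ([(y, s)] @ b @ [(x, s)]) @ map fst Q) (P @ V @ Q') \<and>
      cweight U + cweight Q \<le> cweight V + cweight Q'" (is "\<exists>V Q'. ?good V Q'")
  proof -
    consider (free) "i = 0 \<or> lets i B = {}"
      | (unused) u where "i \<noteq> 0" "u \<in> lets i B" "j = 0"
      | (both) u where "i \<noteq> 0" "u \<in> lets i B" "j \<noteq> 0" by blast
    then show ?thesis
    proof cases
      case free
      have n: "before B [((x, s), i)]" "before [((y, s), j)] [((x, s), i)]" "before [((y, s), j)] B"
        using free ij By by auto
      have "colouring r (map fst P @ ([(y, s)] @ b @ [(x, s)]) @ map fst Q)
         (P @ ([((y, s), j)] @ B @ [((x, s), i)]) @ Q)"
        by (intro colouring_blocksI c n) (simp_all add: U(2) le)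
      then have "?good ([((y, s), j)] @ B @ [((x, s), i)]) Q" using U(1) by simp
      then show ?thesis by blast
    next
      case unused
      have n1: "before [((y, s), i)] Q"
        using le_trans[OF By[of u i] BQ[of i u]] unused by simp
      have n2: "before P [((y, s), i)]" using Px unused xy by fastforce
      have n3: "before B [((x, s), 0)]" "before [((y, s), i)] [((x, s), 0)]" "before [((y, s), i)] B"
        "before P [((x, s), 0)]" "before [((x, s), 0)] Q"
        using unused ij By by auto
      have "colouring r (map fst P @ ([(y, s)] @ b @ [(x, s)]) @ map fst Q)
         (P @ ([((y, s), i)] @ B @ [((x, s), 0)]) @ Q)"
        by (intro colouring_blocksI c n1 n2 n3) (simp_all add: U(2) le)
      then have "?good ([((y, s), i)] @ B @ [((x, s), 0)]) Q" using U(1) unused by simp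
      then show ?thesis by blast
    next
      case both
      then have "i \<noteq> j" using ij by simp
      have Qi: "y \<le> v" if "v \<in> lets i Q" for v
        using le_trans[OF By[of u i] BQ[of i u v]] that both by simp
      consider (1) "\<forall>v \<in> lets j B. \<forall>u \<in> lets i Q. v \<le> u" | (2) "\<forall>v \<in> lets i B. \<forall>u \<in> lets j Q. v \<le> u"
      proof (cases "\<forall>v \<in> lets j B. \<forall>u \<in> lets i Q. v \<le> u")
        case False
        then obtain v u where vu: "v \<in> lets j B" "u \<in> lets i Q" "u < v" by (auto simp: not_le)
        have "v' \<le> u'" if "v' \<in> lets i B" "u' \<in> lets j Q" for v' u'
          using BQ[of i v' u] BQ[of j v u'] vu both that by simp
        then show ?thesis using that by blast
      qed
      then show ?thesis
      proof cases
        case 1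
        let ?B = "recolour (\<lambda>k. if k = i then j else k) B"
        let ?Q = "recolour (\<lambda>k. if k = i then j else if k = j then i else k) Q"
        have w: "cweight ?B = cweight B" "cweight ?Q = cweight Q"
          using both by (auto intro!: cweight_recolour split: if_split_asm)
        have n1: "before P ?B" using le_trans[OF Py By] PB both \<open>i \<noteq> j\<close>
          by (intro before_casesI[of i _ _ j]) auto
        have n2: "before P ?Q"
          using le_trans[OF Py Qi] le_trans[OF le_trans[OF Px less_imp_le[OF xy]] yQ] PQ both
          by (intro before_casesI[of i _ _ j]) (simp_all split: if_split_asm)
        have n3: "before ?B ?Q"
          using 1 BQ both \<open>i \<noteq> j\<close> by (intro before_casesI[of i _ _ j]) auto
        have n5: "before ?B [((x, s), i)]" "before [((y, s), j)] ?B" "before [((y, s), j)] [((x, s), i)]"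
          using By \<open>i \<noteq> j\<close> by auto
        have n6: "before [((x, s), i)] ?Q" using le_trans[OF less_imp_le[OF xy] yQ] both by simp
        have n7: "before [((y, s), j)] ?Q" using Qi \<open>i \<noteq> j\<close> by simp
        have n8: "sorted_wrt compat ?B" using B by (rule sorted_wrt_recolour_sorted)
        have n9: "sorted_wrt compat ?Q"
          using c(10) both by (intro sorted_wrt_recolour) (auto simp: inj_on_def)
        have n10: "\<forall>v \<in> set ?B. snd v \<le> r" "\<forall>v \<in> set ?Q. snd v \<le> r"
          using c(4,5) le by (intro recolour_le; simp)+
        have "colouring r (map fst P @ ([(y, s)] @ b @ [(x, s)]) @ map fst Q)
            (P @ ([((y, s), j)] @ ?B @ [((x, s), i)]) @ ?Q)"
          by (intro colouring_blocksI c n1 n2 n3 n5 n6 n7 n8 n9 n10) (simp_all add: U(2) le)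
        then have "?good ([((y, s), j)] @ ?B @ [((x, s), i)]) ?Q" using U(1) both w by simp
        then show ?thesis by blast
      next
        case 2
        let ?B = "recolour (\<lambda>k. if k = i then j else k) B"
        have w: "cweight ?B = cweight B"
          using both by (auto intro!: cweight_recolour split: if_split_asm)
        have n1: "before P ?B" using le_trans[OF Py By] PB both \<open>i \<noteq> j\<close>
          by (intro before_casesI[of i _ _ j]) auto
        have n2: "before ?B Q"
          using 2 BQ both \<open>i \<noteq> j\<close> by (intro before_casesI[of i _ _ j]) auto
        have n3: "before ?B [((x, s), i)]" "before [((y, s), j)] ?B" "before [((y, s), j)] [((x, s), i)]"
          using By \<open>i \<noteq> j\<close> by auto
        have n4: "sorted_wrt compat ?B" using B by (rule sorted_wrt_recolour_sorted)
        have n5: "\<forall>v \<in> set ?B. snd v \<le> r" using c(4,5) le by (intro recolour_le; simp)+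
        have "colouring r (map fst P @ ([(y, s)] @ b @ [(x, s)]) @ map fst Q)
            (P @ ([((y, s), j)] @ ?B @ [((x, s), i)]) @ Q)"
          by (intro colouring_blocksI c n1 n2 n3 n4 n5) (simp_all add: U(2) le)
        then have "?good ([((y, s), j)] @ ?B @ [((x, s), i)]) Q" using U(1) both w by simp
        then show ?thesis by blast
      qed
    qed
  qed
qed

text \<open>
  The opposite directions are plain: moving the larger letter behind the smaller ones, or the
  smaller letter in front, only allows more increasing subwords.
\<close>

lemma knuth_block_left:
  assumes a: "sorted (map fst a)" "\<And>x. x \<in> set a \<Longrightarrow> fst x \<le> y" and yz: "y < z"
  shows "a @ [(z, s)] @ [(y, s)] \<approx>\<^sub>K [(z, s)] @ a @ [(y, s)]"
  unfolding knuth_eq_def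
proof
  show "dominates ([(z, s)] @ a @ [(y, s)]) (a @ [(z, s)] @ [(y, s)])"
    using assms by (rule knuth_block_left_dom)
  show "dominates (a @ [(z, s)] @ [(y, s)]) ([(z, s)] @ a @ [(y, s)])"
  proof (rule dominatesI)
    fix r P U Q
    assume col: "colouring r (map fst P @ ([(z, s)] @ a @ [(y, s)]) @ map fst Q) (P @ U @ Q)"
      and "map fst U = [(z, s)] @ a @ [(y, s)]"
    from this(2) obtain Z A Y where U: "U = Z @ A @ Y" "map fst Z = [(z, s)]" "map fst A = a" "map fst Y = [(y, s)]"
      by (rule map_eq_appendE)
    obtain i where i: "Z = [((z, s), i)]" using map_fst_single[OF U(2)] by blast
    obtain j where j: "Y = [((y, s), j)]" using map_fst_single[OF U(4)] by blast
    note c = colouring_blocksD[OF col[unfolded U(1)]]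
    have "x \<le> z" if "x \<in> lets k A" for x k
      using lets_letters[OF that] a(2) yz U(3) by fastforce
    then have n: "before A Z" unfolding i by simp
    have "colouring r (map fst P @ (a @ [(z, s)] @ [(y, s)]) @ map fst Q) (P @ (A @ Z @ Y) @ Q)"
      by (intro colouring_blocksI c n U(2-4) refl)
    then show "\<exists>V Q'. map fst Q' = map fst Q \<and>
        colouring r (map fst P @ (a @ [(z, s)] @ [(y, s)]) @ map fst Q) (P @ V @ Q') \<and>
        cweight U + cweight Q \<le> cweight V + cweight Q'"
      using U(1) by (intro exI[of _ "A @ Z @ Y"] exI[of _ Q]) simp
  qed
qed

lemma knuth_block_right:
  assumes b: "sorted (map fst b)" "\<And>v. v \<in> set b \<Longrightarrow> y \<le> fst v" and xy: "x < y"
  shows "[(y, s)] @ b @ [(x, s)] \<approx>\<^sub>K [(y, s)] @ [(x, s)] @ b"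
  unfolding knuth_eq_def
proof
  show "dominates ([(y, s)] @ b @ [(x, s)]) ([(y, s)] @ [(x, s)] @ b)"
    using assms by (rule knuth_block_right_dom)
  show "dominates ([(y, s)] @ [(x, s)] @ b) ([(y, s)] @ b @ [(x, s)])"
  proof (rule dominatesI)
    fix r P U Q
    assume col: "colouring r (map fst P @ ([(y, s)] @ b @ [(x, s)]) @ map fst Q) (P @ U @ Q)"
      and "map fst U = [(y, s)] @ b @ [(x, s)]"
    from this(2) obtain Y B X where U: "U = Y @ B @ X" "map fst Y = [(y, s)]" "map fst B = b" "map fst X = [(x, s)]"
      by (rule map_eq_appendE)
    obtain i where i: "X = [((x, s), i)]" using map_fst_single[OF U(4)] by blast
    note c = colouring_blocksD[OF col[unfolded U(1)]]
    have "x \<le> v" if "v \<in> lets k B" for v k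
      using lets_letters[OF that] b(2) xy U(3) by fastforce
    then have n: "before X B" unfolding i by simp
    have "colouring r (map fst P @ ([(y, s)] @ [(x, s)] @ b) @ map fst Q) (P @ (Y @ X @ B) @ Q)"
      by (intro colouring_blocksI c n U(2-4) refl)
    then show "\<exists>V Q'. map fst Q' = map fst Q \<and>
        colouring r (map fst P @ ([(y, s)] @ [(x, s)] @ b) @ map fst Q) (P @ V @ Q') \<and>
        cweight U + cweight Q \<le> cweight V + cweight Q'"
      using U(1) by (intro exI[of _ "Y @ X @ B"] exI[of _ Q]) simp
  qed
qed

lemma knuth_eq_append: "u \<approx>\<^sub>K u' \<Longrightarrow> v \<approx>\<^sub>K v' \<Longrightarrow> u @ v \<approx>\<^sub>K u' @ v'"
  using knuth_eq_context[of u u' "[]" v] knuth_eq_context[of v v' u' "[]"] knuth_eq_trans by fastforce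

lemma knuth_eq_reduce: "nonneg w \<Longrightarrow> reduce w \<approx>\<^sub>K w"
proof (induction w rule: reduce.induct)
  case (3 c s d t w)
  show ?case
  proof (cases "c = d")
    case True
    have "reduce ((c, s + t) # w) \<approx>\<^sub>K [(c, s + t)] @ w" using 3 True by simp
    also have "[(c, s + t)] @ w \<approx>\<^sub>K [(c, s), (c, t)] @ w"
      using 3 by (intro knuth_eq_append split_segment) simp_all
    finally show ?thesis using True by simp
  next
    case False
    then have "[(c, s)] @ reduce ((d, t) # w) \<approx>\<^sub>K [(c, s)] @ (d, t) # w"
      using 3 by (intro knuth_eq_append) simp_all
    then show ?thesis using False by simp
  qed
qed simp_all

section \<open>Row insertion\<close>

text \<open>The initial part of duration \<open>s\<close> of a word, and the remaining part.\<close>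

fun ttake :: "real \<Rightarrow> tword \<Rightarrow> tword" where
  "ttake s [] = []"
| "ttake s ((c, t) # w) = (if s \<le> 0 then [] else if s < t then [(c, s)] else (c, t) # ttake (s - t) w)"

fun tdrop :: "real \<Rightarrow> tword \<Rightarrow> tword" where
  "tdrop s [] = []"
| "tdrop s ((c, t) # w) = (if s \<le> 0 then (c, t) # w else if s < t then (c, t - s) # w else tdrop (s - t) w)"

lemma ttake_nonpos: "s \<le> 0 \<Longrightarrow> ttake s w = []" "s \<le> 0 \<Longrightarrow> tdrop s w = w"
  by (cases w; auto)+

lemma tlen_ttake: "nonneg w \<Longrightarrow> 0 \<le> s \<Longrightarrow> tlen (ttake s w) = min s (tlen w)"
  using tlen_nonneg by (induction s w rule: ttake.induct) (fastforce simp: min_def split: if_splits)+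

lemma tlen_tdrop: "nonneg w \<Longrightarrow> 0 \<le> s \<Longrightarrow> tlen (tdrop s w) = tlen w - min s (tlen w)"
  using tlen_nonneg by (induction s w rule: tdrop.induct) (fastforce simp: min_def split: if_splits)+

lemma pos_ttake: "pos w \<Longrightarrow> pos (ttake s w)" "pos w \<Longrightarrow> pos (tdrop s w)"
  by (induction s w rule: ttake.induct) auto

lemma ttake_all: "pos w \<Longrightarrow> tlen w \<le> s \<Longrightarrow> ttake s w = w \<and> tdrop s w = []"
proof (induction s w rule: ttake.induct)
  case (2 s c t w)
  then show ?case using tlen_nonneg[of w] pos_nonneg[of w] by auto
qed simp

lemma letter_at_ttake: "0 \<le> x \<Longrightarrow> x < s \<Longrightarrow> letter_at (ttake s w) x = letter_at w x"
  by (induction s w arbitrary: x rule: ttake.induct) auto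

lemma letter_at_tdrop: "nonneg w \<Longrightarrow> 0 \<le> s \<Longrightarrow> 0 \<le> x \<Longrightarrow> letter_at (tdrop s w) x = letter_at w (s + x)"
  by (induction s w arbitrary: x rule: tdrop.induct) (auto simp: algebra_simps)

lemma letters_ttake: "\<exists>n. map fst (ttake s w) = take n (map fst w)"
proof (induction s w rule: ttake.induct)
  case (2 s c t w)
  then obtain n where "\<not> s \<le> 0 \<Longrightarrow> \<not> s < t \<Longrightarrow> map fst (ttake (s - t) w) = take n (map fst w)" by blast
  then show ?case
    by (auto intro: exI[of _ 0] exI[of _ "Suc 0"] exI[of _ "Suc n"])
qed simp

lemma letters_tdrop: "\<exists>n. map fst (tdrop s w) = drop n (map fst w)"
proof (induction s w rule: tdrop.induct)
  case (2 s c t w)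
  then obtain n where "\<not> s \<le> 0 \<Longrightarrow> \<not> s < t \<Longrightarrow> map fst (tdrop (s - t) w) = drop n (map fst w)" by blast
  then show ?case
    by (auto intro: exI[of _ 0] exI[of _ "Suc n"])
qed simp

lemma set_ttake: "x \<in> set (ttake s w) \<Longrightarrow> fst x \<in> fst ` set w"
  using letters_ttake[of s w] by (metis image_eqI in_set_takeD list.set_map)

lemma set_tdrop: "x \<in> set (tdrop s w) \<Longrightarrow> fst x \<in> fst ` set w"
  using letters_tdrop[of s w] by (metis image_eqI in_set_dropD list.set_map)

lemma timed_row_ttake: assumes "timed_row w" shows "timed_row (ttake s w)" "timed_row (tdrop s w)"
proof -
  obtain m n where "map fst (ttake s w) = take m (map fst w)" "map fst (tdrop s w) = drop n (map fst w)"
    using letters_ttake letters_tdrop by metis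
  then show "timed_row (ttake s w)" "timed_row (tdrop s w)"
    using assms by (auto simp: timed_row_iff pos_ttake sorted_wrt_take sorted_wrt_drop)
qed

lemma timed_row_sorted: "timed_row w \<Longrightarrow> sorted (map fst w)"
  by (auto simp: timed_row_iff strict_sorted_imp_sorted)

lemma timed_row_append: "timed_row (u @ v) \<Longrightarrow> timed_row u \<and> timed_row v"
  by (auto simp: timed_row_iff sorted_wrt_append)

lemma timed_row_reduced: "timed_row w \<Longrightarrow> reduced w"
  by (simp add: timed_row_def)

lemma timed_row_pos: "timed_row w \<Longrightarrow> pos w"
  by (simp add: timed_row_iff)

lemma knuth_eq_ttake: "nonneg w \<Longrightarrow> ttake s w @ tdrop s w \<approx>\<^sub>K w"
proof (induction s w rule: ttake.induct)
  case (2 s c t w)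
  consider "s \<le> 0" | "0 < s" "s < t" | "0 < s" "t \<le> s" by linarith
  then show ?case
  proof cases
    case 2
    then have "[(c, s), (c, t - s)] @ w \<approx>\<^sub>K [(c, t)] @ w"
      using split_segment[of s "t - s" c] by (intro knuth_eq_append knuth_eq_sym[of "[(c, t)]"]) simp_all
    then show ?thesis using 2 by simp
  next
    case 3
    then have "[(c, t)] @ (ttake (s - t) w @ tdrop (s - t) w) \<approx>\<^sub>K [(c, t)] @ w"
      using 2 by (intro knuth_eq_append) simp_all
    then show ?thesis using 3 by simp
  qed simp
qed simp

text \<open>The decomposition of a row at the position where a segment of letter \<open>c\<close> is inserted.\<close>

lemma row_split:
  assumes "timed_row u"
  obtains a b where "u = a @ b" "timed_row a" "timed_row b" "\<And>x. x \<in> set a \<Longrightarrow> fst x \<le> c"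
    "\<And>x. x \<in> set b \<Longrightarrow> c < fst x"
proof -
  let ?a = "takeWhile (\<lambda>x. fst x \<le> c) u" and ?b = "dropWhile (\<lambda>x. fst x \<le> c) u"
  have u: "u = ?a @ ?b" by simp
  then have rows: "timed_row ?a" "timed_row ?b" using timed_row_append[of ?a ?b] assms by simp_all
  have "c < fst x" if x: "x \<in> set ?b" for x
  proof -
    obtain y v where v: "?b = y # v" using x by (cases ?b) auto
    have "c < fst y" using hd_dropWhile[of "\<lambda>x. fst x \<le> c" u] v by force
    moreover have "fst y \<le> fst x" using timed_row_sorted[OF rows(2)] x unfolding v by auto
    ultimately show ?thesis by simp
  qed
  then show ?thesis using that[OF u rows] by (auto dest: set_takeWhileD)
qed

lemma rins_letter_eq:
  assumes row: "timed_row (a @ b)" and s: "0 < s"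
    and a: "\<And>x. x \<in> set a \<Longrightarrow> fst x \<le> c" and b: "\<And>x. x \<in> set b \<Longrightarrow> c < fst x"
  shows "rins_letter (a @ b) (c, s) = (ttake s b, tconc (tconc a [(c, s)]) (tdrop s b))"
proof -
  have rows: "timed_row a" "timed_row b" using timed_row_append[OF row] by auto
  note p = timed_row_pos[OF rows(1)] timed_row_pos[OF rows(2)]
  have nn: "nonneg a" "nonneg b" "0 \<le> tlen a" "0 \<le> tlen b" using p by (auto simp: pos_nonneg tlen_nonneg)
  have la: "letter_at (a @ b) x \<le> c" if "0 \<le> x" "x < tlen a" for x
    using letter_at_in[of a x] a that nn by (auto simp: letter_at_append)
  have lb: "c < letter_at (a @ b) x" if "tlen a \<le> x" "x < tlen a + tlen b" for x
    using letter_at_in[of b "x - tlen a"] b that nn by (auto simp: letter_at_append)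
  show ?thesis
  proof (cases "b = []")
    case True
    have "reduce (reduce (a @ [(c, s)])) = reduce (a @ [(c, s)])"
      using p s by (intro reduce_id reduced_reduce) auto
    then show ?thesis using True la by (auto simp: rins_letter_def tconc_def)
  next
    case False
    then have bp: "0 < tlen b" using p tlen_pos by auto
    have ex: "\<not> (\<forall>t. 0 \<le> t \<and> t < tlen (a @ b) \<longrightarrow> letter_at (a @ b) t \<le> c)"
      using lb[of "tlen a"] bp nn by (auto intro!: exI[of _ "tlen a"])
    have t0: "(LEAST t. 0 \<le> t \<and> t < tlen (a @ b) \<and> c < letter_at (a @ b) t) = tlen a"
    proof (rule Least_equality)
      show "0 \<le> tlen a \<and> tlen a < tlen (a @ b) \<and> c < letter_at (a @ b) (tlen a)"
        using lb[of "tlen a"] bp nn by auto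
      show "tlen a \<le> y" if "0 \<le> y \<and> y < tlen (a @ b) \<and> c < letter_at (a @ b) y" for y
        using la[of y] that by force
    qed
    have sa: "segment (a @ b) 0 (tlen a) = a"
      unfolding segment_def using nn rows
      by (intro tword_of_eqI) (auto simp: timed_row_reduced letter_at_append)
    show ?thesis
    proof (cases "s < tlen b")
      case True
      have "segment (a @ b) (tlen a) (tlen a + s) = ttake s b"
        unfolding segment_def using nn rows s True timed_row_ttake[OF rows(2)]
        by (intro tword_of_eqI) (auto simp: timed_row_reduced letter_at_append letter_at_ttake tlen_ttake)
      moreover have "segment (a @ b) (tlen a + s) (tlen (a @ b)) = tdrop s b"
        unfolding segment_def using nn rows s True timed_row_ttake[OF rows(2)]
        by (intro tword_of_eqI)
          (auto simp: timed_row_reduced letter_at_append letter_at_tdrop tlen_tdrop add.commute)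
      ultimately show ?thesis using True unfolding rins_letter_def prod.case t0 Let_def sa if_not_P[OF ex] by simp
    next
      case False
      have "segment (a @ b) (tlen a) (tlen (a @ b)) = b"
        unfolding segment_def using nn rows
        by (intro tword_of_eqI) (auto simp: timed_row_reduced letter_at_append)
      moreover have "reduce (reduce (a @ [(c, s)])) = reduce (a @ [(c, s)])"
        using p s by (intro reduce_id reduced_reduce) auto
      ultimately show ?thesis using False ttake_all[of b s] p
        unfolding rins_letter_def prod.case t0 Let_def sa if_not_P[OF ex] by (simp add: tconc_def)
    qed
  qed
qed

text \<open>
  The part \<open>v\<close> that is displaced by \<open>c\<^sup>s\<close> can be moved to the front of the row, with \<open>c\<^sup>s\<close> in
  its place. This is done one segment \<open>d\<^sup>q\<close> of \<open>v\<close> at a time, using a piece \<open>c\<^sup>q\<close> of the same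
  duration.
\<close>

lemma knuth_eq_bump:
  assumes "sorted (map fst a)" "\<And>x. x \<in> set a \<Longrightarrow> fst x \<le> c"
    and "sorted (map fst (v @ b))" "\<And>x. x \<in> set (v @ b) \<Longrightarrow> c < fst x"
    and "nonneg v" "tlen v \<le> s" "b = [] \<or> tlen v = s"
  shows "a @ v @ b @ [(c, s)] \<approx>\<^sub>K v @ a @ [(c, s)] @ b"
  using assms
proof (induction v arbitrary: a s)
  case Nil
  show ?case
  proof (cases "b = []")
    case False
    then have "s = 0" using Nil by simp
    have "a @ b @ [(c, s)] \<approx>\<^sub>K a @ b @ []"
      using zero_segment \<open>s = 0\<close> by (intro knuth_eq_append) simp_all
    also have "a @ b @ [] = a @ [] @ b" by simp
    also have "a @ [] @ b \<approx>\<^sub>K a @ [(c, s)] @ b"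
      using zero_segment \<open>s = 0\<close> by (intro knuth_eq_append knuth_eq_sym[of "[(c, s)]"]) simp_all
    finally show ?thesis by simp
  qed simp
next
  case (Cons x v)
  obtain d q where x: "x = (d, q)" by (cases x)
  have q: "0 \<le> q" "q \<le> s" using Cons.prems x tlen_nonneg[of v] by auto
  have split: "[(c, s)] \<approx>\<^sub>K [(c, q)] @ [(c, s - q)]" using split_segment[of q "s - q" c] q by simp
  have dle: "d \<le> fst y" if "y \<in> set (v @ b)" for y
    using Cons.prems(3) that unfolding x by auto
  have cd: "c < d" using Cons.prems(4)[of x] x by simp
  have IH: "(a @ [(c, q)]) @ v @ b @ [(c, s - q)] \<approx>\<^sub>K v @ (a @ [(c, q)]) @ [(c, s - q)] @ b"
  proof (rule Cons.IH)
    show "sorted (map fst (a @ [(c, q)]))" using Cons.prems(1,2) by (auto simp: sorted_append)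
    show "sorted (map fst (v @ b))" using Cons.prems(3) by simp
    show "fst y \<le> c" if "y \<in> set (a @ [(c, q)])" for y using that Cons.prems(2)[of y] by auto
    show "c < fst y" if "y \<in> set (v @ b)" for y using that Cons.prems(4) by auto
  qed (use Cons.prems x in auto)
  have "a @ (x # v) @ b @ [(c, s)] = (a @ [(d, q)] @ v @ b) @ [(c, s)]" by (simp add: x)
  also have "(a @ [(d, q)] @ v @ b) @ [(c, s)] \<approx>\<^sub>K (a @ [(d, q)] @ v @ b) @ [(c, q)] @ [(c, s - q)]"
    using split by (intro knuth_eq_append) simp_all
  also have "\<dots> = a @ ([(d, q)] @ (v @ b) @ [(c, q)]) @ [(c, s - q)]" by simp
  also have "\<dots> \<approx>\<^sub>K a @ ([(d, q)] @ [(c, q)] @ (v @ b)) @ [(c, s - q)]"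
    using Cons.prems(3) dle cd by (intro knuth_eq_append knuth_eq_refl knuth_block_right) auto
  also have "\<dots> = (a @ [(d, q)] @ [(c, q)]) @ v @ b @ [(c, s - q)]" by simp
  also have "\<dots> \<approx>\<^sub>K ([(d, q)] @ a @ [(c, q)]) @ v @ b @ [(c, s - q)]"
    using Cons.prems(1,2) cd by (intro knuth_eq_append knuth_eq_refl knuth_block_left) auto
  also have "\<dots> = [(d, q)] @ ((a @ [(c, q)]) @ v @ b @ [(c, s - q)])" by simp
  also have "\<dots> \<approx>\<^sub>K [(d, q)] @ (v @ (a @ [(c, q)]) @ [(c, s - q)] @ b)"
    by (rule knuth_eq_append[OF knuth_eq_refl IH])
  also have "\<dots> = ([(d, q)] @ v @ a) @ ([(c, q)] @ [(c, s - q)]) @ b" by simp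
  also have "\<dots> \<approx>\<^sub>K ([(d, q)] @ v @ a) @ [(c, s)] @ b"
    using split by (intro knuth_eq_append knuth_eq_refl knuth_eq_sym[of "[(c, s)]"])
  finally show ?case by (simp add: x)
qed

text \<open>The duration of the letters smaller than \<open>d\<close>.\<close>

definition below :: "tword \<Rightarrow> nat \<Rightarrow> real" where
  "below w d = tlen (filter (\<lambda>x. fst x < d) w)"

lemma below_simps [simp]: "below [] d = 0"
  "below (x # w) d = (if fst x < d then snd x else 0) + below w d"
  "below (u @ v) d = below u d + below v d"
  by (auto simp: below_def)

lemma below_0 [simp]: "below w 0 = 0"
  by (simp add: below_def)

lemma below_nonneg: "nonneg w \<Longrightarrow> 0 \<le> below w d"
  by (induction w) auto

lemma below_mono: "nonneg w \<Longrightarrow> d \<le> e \<Longrightarrow> below w d \<le> below w e"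
  by (induction w) auto

lemma below_eq_0: "(\<And>x. x \<in> set w \<Longrightarrow> d \<le> fst x) \<Longrightarrow> below w d = 0"
  by (induction w) (auto simp: not_less[symmetric])

lemma below_eq_tlen: "(\<And>x. x \<in> set w \<Longrightarrow> fst x < d) \<Longrightarrow> below w d = tlen w"
  by (induction w) auto

lemma below_reduce [simp]: "below (reduce w) d = below w d"
  by (induction w rule: reduce.induct) auto

lemma below_ttake_tdrop: "below (ttake s w) d + below (tdrop s w) d = below w d"
  by (induction s w rule: ttake.induct) auto

lemma below_ttake:
  "timed_row w \<Longrightarrow> 0 \<le> s \<Longrightarrow> below (ttake s w) d = min s (below w d)"
proof (induction s w rule: ttake.induct)
  case (2 s c t w)
  have w: "timed_row w" "0 < t" "nonneg w" using 2 by (auto simp: timed_row_iff pos_nonneg)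
  have "0 \<le> below w d" using w by (simp add: below_nonneg)
  moreover have "below w d = 0" if "\<not> c < d"
    using 2(2) that by (intro below_eq_0) (force simp: timed_row_iff)
  ultimately show ?case using 2 w by (auto simp: min_def ttake_nonpos)
qed simp

lemma ttake_le_tdrop:
  "sorted (map fst w) \<Longrightarrow> x \<in> set (ttake s w) \<Longrightarrow> y \<in> set (tdrop s w) \<Longrightarrow> fst x \<le> fst y"
proof (induction s w rule: ttake.induct)
  case (2 s c t w)
  then show ?case using set_tdrop[of y "s - t" w] by (auto split: if_splits)
qed simp

text \<open>
  The effect of the insertion of a segment on a row. The new row is described by the durations
  \<open>below u' d\<close>: the segment \<open>c\<^sup>s\<close> starts at the time \<open>below u (Suc c)\<close> and overwrites the letters
  there, so that afterwards the letters at most \<open>c\<close> last until \<open>below u (Suc c) + s\<close>.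
\<close>

lemma rins_letter_row:
  assumes "timed_row u" "0 < s" and r: "rins_letter u (c, s) = (v, u')"
  shows "timed_row v" "timed_row u'" "u @ [(c, s)] \<approx>\<^sub>K v @ u'"
    "\<And>x. x \<in> set v \<Longrightarrow> c < fst x" "fst ` set v \<subseteq> fst ` set u" "fst ` set u' \<subseteq> insert c (fst ` set u)"
    "\<And>x y. x \<in> set v \<Longrightarrow> y \<in> set u' \<Longrightarrow> c < fst y \<Longrightarrow> fst x \<le> fst y"
    "\<And>d. below u' d = (if d \<le> c then below u d else max (below u d) (below u (Suc c) + s))"
    "\<And>d. below v d + below u' d = below u d + (if c < d then s else 0)"
proof -
  obtain a b where u: "u = a @ b" and rows: "timed_row a" "timed_row b"
    and a: "\<And>x. x \<in> set a \<Longrightarrow> fst x \<le> c" and b: "\<And>x. x \<in> set b \<Longrightarrow> c < fst x"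
    using row_split[OF assms(1), of c] by metis
  note p = timed_row_pos[OF rows(1)] timed_row_pos[OF rows(2)]
  note nn = p[THEN pos_nonneg]
  define f where "f = tdrop s b"
  have v: "v = ttake s b" and u': "u' = tconc (tconc a [(c, s)]) f"
    using r rins_letter_eq[of a b s c] assms(1,2) u a b by (auto simp: f_def)
  note rowsb = timed_row_ttake[OF rows(2), of s, folded v f_def]
  have pf: "pos f" using rowsb by (simp add: timed_row_pos)
  have pa: "pos (a @ [(c, s)])" using p assms(2) by simp
  show "timed_row v" using rowsb by simp
  have lv: "fst x \<in> fst ` set b" if "x \<in> set v" for x using set_ttake that by (auto simp: v)
  have lf: "fst x \<in> fst ` set b" if "x \<in> set f" for x using set_tdrop that by (auto simp: f_def)
  show cv: "c < fst x" if "x \<in> set v" for x using lv[OF that] b by auto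
  have cf: "c < fst x" if "x \<in> set f" for x using lf[OF that] b by auto
  show "fst ` set v \<subseteq> fst ` set u" using lv u by auto
  have letters_u': "fst ` set u' = fst ` set a \<union> {c} \<union> fst ` set f"
    by (simp add: u' tconc_def image_Un)
  then show "fst ` set u' \<subseteq> insert c (fst ` set u)" using lf u by auto
  have vlef: "fst x \<le> fst y" if "x \<in> set v" "y \<in> set f" for x y
    using ttake_le_tdrop timed_row_sorted[OF rows(2)] that unfolding v f_def by blast
  have "sorted (map fst (a @ [(c, s)]))"
    using timed_row_sorted[OF rows(1)] a by (auto simp: sorted_append)
  then have "sorted (map fst (reduce (a @ [(c, s)])))" using pa by (simp add: sorted_reduce_iff)
  moreover have "x \<le> y" if "x \<in> fst ` set (reduce (a @ [(c, s)]))" "y \<in> fst ` set f" for x y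
  proof -
    have "x \<le> c" using that(1) a by auto
    moreover have "c < y" using that(2) cf by auto
    ultimately show ?thesis by simp
  qed
  ultimately have "sorted (map fst (reduce (a @ [(c, s)]) @ f))"
    using timed_row_sorted[OF rowsb(2)] by (auto simp: sorted_append)
  then show "timed_row u'" unfolding u' tconc_def
    using pa pf by (subst timed_row_reduce_iff) (simp_all add: pos_reduce)
  have "u' \<approx>\<^sub>K reduce (a @ [(c, s)]) @ f"
    unfolding u' tconc_def using pa pf by (intro knuth_eq_reduce) (simp add: pos_nonneg pos_reduce)
  also have "\<dots> \<approx>\<^sub>K (a @ [(c, s)]) @ f"
    using pa by (intro knuth_eq_append knuth_eq_refl knuth_eq_reduce) (simp add: pos_nonneg)
  finally have ku: "u' \<approx>\<^sub>K (a @ [(c, s)]) @ f" .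
  have vf: "v @ f \<approx>\<^sub>K b" unfolding v f_def using nn by (intro knuth_eq_ttake)
  have "u @ [(c, s)] = a @ b @ [(c, s)]" by (simp add: u)
  also have "\<dots> \<approx>\<^sub>K a @ (v @ f) @ [(c, s)]"
    by (intro knuth_eq_append knuth_eq_refl knuth_eq_sym[OF vf])
  also have "\<dots> = a @ v @ f @ [(c, s)]" by simp
  also have "\<dots> \<approx>\<^sub>K v @ a @ [(c, s)] @ f"
  proof (rule knuth_eq_bump)
    show "sorted (map fst a)" using rows by (simp add: timed_row_sorted)
    obtain m n where mn: "map fst v = take m (map fst b)" "map fst f = drop n (map fst b)"
      using letters_ttake letters_tdrop unfolding v f_def by metis
    have vlen: "tlen v = min s (tlen b)" unfolding v using nn assms(2) by (simp add: tlen_ttake)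
    show "tlen v \<le> s" using vlen by simp
    show "f = [] \<or> tlen v = s" using vlen ttake_all[OF p(2), of s] unfolding f_def by (auto simp: min_def)
    show "nonneg v" using rowsb by (simp add: timed_row_pos pos_nonneg)
    show "sorted (map fst (v @ f))"
      using rowsb[THEN timed_row_sorted] vlef by (auto simp: sorted_append)
  qed (use a cv cf in auto)
  also have "\<dots> = v @ ((a @ [(c, s)]) @ f)" by simp
  also have "\<dots> \<approx>\<^sub>K v @ u'" by (intro knuth_eq_append knuth_eq_refl knuth_eq_sym[OF ku])
  finally show "u @ [(c, s)] \<approx>\<^sub>K v @ u'" .
  show "fst x \<le> fst y" if "x \<in> set v" "y \<in> set u'" "c < fst y" for x y
  proof -
    have "fst y \<in> fst ` set a \<union> {c} \<union> fst ` set f" using that(2) letters_u' by blast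
    moreover have "fst y \<notin> fst ` set a" "fst y \<noteq> c" using a that(3) by fastforce+
    ultimately obtain y' where "y' \<in> set f" "fst y = fst y'" by auto
    then show ?thesis using vlef[OF that(1)] by simp
  qed
  have bu': "below u' d = below a d + (if c < d then s else 0) + below f d" for d
    by (simp add: u' tconc_def)
  have bv: "below v d = min s (below b d)" for d
    unfolding v using rows assms(2) by (simp add: below_ttake)
  have bvf: "below v d + below f d = below b d" for d
    unfolding v f_def by (rule below_ttake_tdrop)
  show "below v d + below u' d = below u d + (if c < d then s else 0)" for d
    using bu'[of d] bvf[of d] by (simp add: u)
  show "below u' d = (if d \<le> c then below u d else max (below u d) (below u (Suc c) + s))" for d
  proof (cases "d \<le> c")
    case True
    have "below b d = 0" using True b by (intro below_eq_0) fastforce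
    then show ?thesis using True bu'[of d] bvf[of d] bv[of d] assms(2) by (simp add: u)
  next
    case False
    have "below a e = tlen a" if "c < e" for e
      using a le_less_trans that by (intro below_eq_tlen) blast
    then have "below a d = tlen a" "below a (Suc c) = tlen a" using False by auto
    moreover have "below b (Suc c) = 0" using b by (intro below_eq_0) fastforce
    ultimately show ?thesis using False bu'[of d] bvf[of d] bv[of d] by (auto simp: u)
  qed
qed

lemma rins_simps: "rins u [] = ([], u)"
  "rins u (v @ [x]) = (let (v', u') = rins u v; (v'', u'') = rins_letter u' x in (tconc v' v'', u''))"
  by (auto simp: rins_def split: prod.splits)

text \<open>
  The insertion of a row \<open>v\<close> into a row \<open>u\<close>, giving the bumped row \<open>v'\<close> and the new row \<open>u'\<close>. The
  total duration of each letter is preserved; a bumped letter is larger than the one that bumps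
  it; as \<open>v\<close> is increasing, none of its letters is bumped again; the time at
  which the letters smaller than \<open>d\<close> end does not decrease. The last inequality bounds the time when the
  letters smaller than \<open>d\<close> of \<open>u'\<close> end: this is the time for \<open>u\<close>, or there is a letter \<open>e < d\<close> of
  \<open>v\<close> such that the letters of \<open>v\<close> from \<open>e\<close> up to \<open>d\<close> fill the whole time after the letters at
  most \<open>e\<close> of \<open>u\<close>.
\<close>

lemma rins_row:
  assumes "timed_row u" "timed_row v" and r: "rins u v = (v', u')"
  shows "timed_row v'" "timed_row u'" "u @ v \<approx>\<^sub>K v' @ u'"
    "\<And>d. below v' d + below u' d = below u d + below v d"
    "\<And>d. below v' (Suc d) \<le> below v d"
    "\<And>d e. d \<le> e \<Longrightarrow> below v e - below v d \<le> below u' e - below u' d"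
    "\<And>d. below u d \<le> below u' d"
    "\<And>d X. below u d \<le> X \<Longrightarrow> 
       (\<And>e. e \<in> fst ` set v \<Longrightarrow> e < d \<Longrightarrow> below u (Suc e) + (below v d - below v e) \<le> X) \<Longrightarrow>
       below u' d \<le> X"
    "fst ` set v' \<subseteq> fst ` set u \<union> fst ` set v" "fst ` set u' \<subseteq> fst ` set u \<union> fst ` set v"
proof -
  \<comment> \<open>That \<open>v'\<close> is a row follows by induction from the last but one conjunct: what has been bumped
    so far is at most any letter of the row that can still be bumped.\<close>
  have "timed_row v' \<and> timed_row u' \<and> u @ v \<approx>\<^sub>K v' @ u' \<and>
    (\<forall>d. below v' d + below u' d = below u d + below v d) \<and>
    (\<forall>d. below v' (Suc d) \<le> below v d) \<and>
    (\<forall>d e. d \<le> e \<longrightarrow> below v e - below v d \<le> below u' e - below u' d) \<and>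
    (\<forall>d. below u d \<le> below u' d) \<and>
    (\<forall>d X. below u d \<le> X \<longrightarrow> 
       (\<forall>e. e \<in> fst ` set v \<longrightarrow> e < d \<longrightarrow> below u (Suc e) + (below v d - below v e) \<le> X) \<longrightarrow>
       below u' d \<le> X) \<and>
    fst ` set v' \<subseteq> fst ` set u \<union> fst ` set v \<and> fst ` set u' \<subseteq> fst ` set u \<union> fst ` set v \<and>
    (\<forall>x \<in> set v'. \<forall>y \<in> set u'. fst (last v) < fst y \<longrightarrow> fst x \<le> fst y) \<and>
    (v = [] \<longrightarrow> v' = [])"
    using assms(2) r
  proof (induction v arbitrary: v' u' rule: rev_induct)
    case Nil
    then have "v' = []" "u' = u" by (auto simp: rins_simps)
    then show ?case using assms(1) below_mono[of u] timed_row_pos[OF assms(1)]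
      by (auto simp: pos_nonneg timed_row_iff)
  next
    case (snoc x v)
    obtain c s where x: "x = (c, s)" by (cases x)
    obtain v0 u0 where 0: "rins u v = (v0, u0)" by (cases "rins u v")
    obtain w where w: "rins_letter u0 (c, s) = (w, u')" and v': "v' = tconc v0 w"
      using snoc.prems(2) 0 x by (auto simp: rins_simps split: prod.splits)
    have row: "timed_row v" "0 < s" and vc: "\<And>y. y \<in> set v \<Longrightarrow> fst y < c"
      using snoc.prems(1) x by (auto simp: timed_row_iff sorted_wrt_append)
    note IH = snoc.IH[OF row(1) 0]
    have u0: "timed_row u0" and v0: "timed_row v0" using IH by auto
    note step = rins_letter_row[OF u0 row(2) w]
    note nn = timed_row_pos[OF u0, THEN pos_nonneg] timed_row_pos[OF step(1), THEN pos_nonneg]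
       timed_row_pos[OF row(1), THEN pos_nonneg] timed_row_pos[OF assms(1), THEN pos_nonneg]
    have pos: "pos (v0 @ w)" using v0 step(1) by (simp add: timed_row_pos)
    have V: "below (v @ [x]) d = below v d + (if c < d then s else 0)" for d by (simp add: x)
    have vbig: "below v d = tlen v" if "c \<le> d" for d
      using vc that by (intro below_eq_tlen) (auto intro: less_le_trans)
    have V': "below v' d = below v0 d + below w d" for d by (simp add: v' tconc_def)
    have i: "below v0 d + below u0 d = below u d + below v d" "below v0 (Suc d) \<le> below v d"
      "below u d \<le> below u0 d" for d using IH by auto
    have im: "below v e - below v d \<le> below u0 e - below u0 d" if "d \<le> e" for d e using IH that by auto
    have ix: "below u0 d \<le> X" if "below u d \<le> X" 
       "\<And>e. e \<in> fst ` set v \<Longrightarrow> e < d \<Longrightarrow> below u (Suc e) + (below v d - below v e) \<le> X" for d X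
      using IH that by blast
    have sep: "fst y \<le> fst z" if "y \<in> set v0" "z \<in> set u0" "c \<le> fst z" for y z
    proof -
      have "v \<noteq> []" using IH that by auto
      moreover have "fst (last v) < fst z" using vc[of "last v"] \<open>v \<noteq> []\<close> that by simp
      ultimately show ?thesis using IH that by blast
    qed
    have letters: "fst ` set v0 \<subseteq> fst ` set u \<union> fst ` set v" "fst ` set u0 \<subseteq> fst ` set u \<union> fst ` set v"
      using IH by auto
    have "sorted (map fst (v0 @ w))"
    proof -
      have "fst y \<le> fst z" if "y \<in> set v0" "z \<in> set w" for y z
      proof -
        have "fst z \<in> fst ` set u0" using step(5) that by blast
        then obtain z' where "z' \<in> set u0" "fst z' = fst z" by auto
        then show ?thesis using sep[of y z'] step(4)[of z] that by simp
      qed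
      then show ?thesis using timed_row_sorted v0 step(1) by (auto simp: sorted_append)
    qed
    then have 1: "timed_row v'" unfolding v' tconc_def using pos by (simp add: timed_row_reduce_iff)
    have IH2: "u @ v \<approx>\<^sub>K v0 @ u0" using IH by blast
    have "u @ v @ [x] = (u @ v) @ [x]" by simp
    also have "\<dots> \<approx>\<^sub>K (v0 @ u0) @ [x]" by (rule knuth_eq_append[OF IH2 knuth_eq_refl])
    also have "\<dots> = v0 @ (u0 @ [(c, s)])" by (simp add: x)
    also have "\<dots> \<approx>\<^sub>K v0 @ (w @ u')" by (intro knuth_eq_append knuth_eq_refl step(3))
    also have "\<dots> = (v0 @ w) @ u'" by simp
    also have "\<dots> \<approx>\<^sub>K v' @ u'" unfolding v' tconc_def
      using pos by (intro knuth_eq_append knuth_eq_refl knuth_eq_sym[OF knuth_eq_reduce]) (simp add: pos_nonneg)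
    finally have 2: "u @ v @ [x] \<approx>\<^sub>K v' @ u'" .
    have 3: "below v' d + below u' d = below u d + below (v @ [x]) d" for d
      using step(9)[of d] i(1)[of d] V V' by simp
    have 4: "below v' (Suc d) \<le> below (v @ [x]) d" for d
    proof (cases "c < d")
      case True
      then have "below w (Suc d) \<le> s" using step(8)[of "Suc d"] step(9)[of "Suc d"] by (simp add: max_def split: if_splits)
      then show ?thesis using i(2)[of d] True V V' by simp
    next
      case False
      then have "below w (Suc d) = 0" using step(4) by (intro below_eq_0) fastforce
      then show ?thesis using i(2)[of d] False V V' by simp
    qed
    have 5: "below (v @ [x]) e - below (v @ [x]) d \<le> below u' e - below u' d" if "d \<le> e" for d e
    proof -
      consider "e \<le> c" | "d \<le> c" "c < e" | "c < d" by linarith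
      then show ?thesis
      proof cases
        case 1
        then show ?thesis using im[OF that] that V step(8) by simp
      next
        case 2
        have "below u0 c \<le> below u0 (Suc c)" using nn by (intro below_mono) auto
        then show ?thesis using im[OF 2(1)] 2 V vbig[of e] vbig[of c] step(8)[of d] step(8)[of e] by simp
      next
        case 3
        have "below u0 d \<le> below u0 e" using nn that by (intro below_mono) auto
        then show ?thesis using 3 that V vbig[of e] vbig[of d] step(8)[of d] step(8)[of e] by simp
      qed
    qed
    have 6: "below u d \<le> below u' d" for d using i(3)[of d] step(8)[of d] by (simp add: max_def)
    have 7: "below u' d \<le> X" if X: "below u d \<le> X" 
       "\<And>e. e \<in> fst ` set (v @ [x]) \<Longrightarrow> e < d \<Longrightarrow> below u (Suc e) + (below (v @ [x]) d - below (v @ [x]) e) \<le> X" for d X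
    proof (cases "d \<le> c")
      case True
      have "below u0 d \<le> X"
      proof (rule ix[OF X(1)])
        fix e assume "e \<in> fst ` set v" "e < d"
        then show "below u (Suc e) + (below v d - below v e) \<le> X" using X(2)[of e] V True by simp
      qed
      then show ?thesis using step(8)[of d] True by simp
    next
      case False
      have ev: "below u (Suc e) + (below v d - below v e) + s \<le> X" if "e \<in> fst ` set v" for e
      proof -
        have "e < c" using vc that by auto
        then show ?thesis using X(2)[of e] that V False by simp
      qed
      have "below u0 d \<le> X"
        using ev row(2) by (intro ix[OF X(1)]) fastforce
      moreover have "below u0 (Suc c) \<le> X - s"
      proof (rule ix)
        have "below u (Suc c) + s \<le> X" using X(2)[of c] False V vbig[of d] vbig[of c] x by simp
        then show "below u (Suc c) \<le> X - s" by simp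
        show "below u (Suc e) + (below v (Suc c) - below v e) \<le> X - s" if "e \<in> fst ` set v" "e < Suc c" for e
          using ev[OF that(1)] vbig[of d] vbig[of "Suc c"] False by simp
      qed
      ultimately show ?thesis using step(8)[of d] False by simp
    qed
    have 8: "fst ` set v' \<subseteq> fst ` set u \<union> fst ` set (v @ [x])" "fst ` set u' \<subseteq> fst ` set u \<union> fst ` set (v @ [x])"
    proof -
      have "fst ` set v' = fst ` set v0 \<union> fst ` set w" by (simp add: v' tconc_def image_Un)
      moreover have "fst ` set (v @ [x]) = insert c (fst ` set v)" by (simp add: x)
      moreover have "V0 \<union> W \<subseteq> U \<union> insert c V \<and> U' \<subseteq> U \<union> insert c V"
        if "V0 \<subseteq> U \<union> V" "U0 \<subseteq> U \<union> V" "W \<subseteq> U0" "U' \<subseteq> insert c U0" for V0 U0 U V W U' :: "nat set"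
        using that by blast
      note this[OF letters step(5,6)]
      ultimately show "fst ` set v' \<subseteq> fst ` set u \<union> fst ` set (v @ [x])"
        "fst ` set u' \<subseteq> fst ` set u \<union> fst ` set (v @ [x])" by simp_all
    qed
    have 9: "fst y \<le> fst z" if yz: "y \<in> set v'" "z \<in> set u'" "fst (last (v @ [x])) < fst z" for y z
    proof -
      have cz: "c < fst z" using yz by (simp add: x)
      have "fst z \<in> insert c (fst ` set u0)" using step(6) yz(2) by blast
      then obtain z' where z': "z' \<in> set u0" "fst z' = fst z" using cz by auto
      have "fst y \<in> fst ` set (v0 @ w)" using yz(1) by (metis v' tconc_def letters_reduce image_eqI)
      then obtain y' where y': "y' \<in> set v0 \<union> set w" "fst y = fst y'" by auto
      then show ?thesis using sep[of y' z'] step(7)[OF _ yz(2) cz, of y'] z' cz by auto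
    qed
    show ?case
    proof (intro conjI allI ballI impI)
      fix d X
      assume X: "below u d \<le> X" "\<forall>e. e \<in> fst ` set (v @ [x]) \<longrightarrow> e < d \<longrightarrow>
        below u (Suc e) + (below (v @ [x]) d - below (v @ [x]) e) \<le> X"
      show "below u' d \<le> X" by (rule 7[OF X(1) X(2)[rule_format]])
    qed (fact 1 2 3 4 5 6 8 9 step(2) | simp)+
  qed
  note * = this
  show "timed_row v'" "timed_row u'" "u @ v \<approx>\<^sub>K v' @ u'"
    "fst ` set v' \<subseteq> fst ` set u \<union> fst ` set v" "fst ` set u' \<subseteq> fst ` set u \<union> fst ` set v"
    using * by argo+
  have "\<forall>d. below v' d + below u' d = below u d + below v d" using * by argo
  then show "below v' d + below u' d = below u d + below v d" for d by blast
  have "\<forall>d. below v' (Suc d) \<le> below v d" using * by argo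
  then show "below v' (Suc d) \<le> below v d" for d by blast
  have "\<forall>d e. d \<le> e \<longrightarrow> below v e - below v d \<le> below u' e - below u' d" using * by argo
  then show "below v e - below v d \<le> below u' e - below u' d" if "d \<le> e" for d e using that by blast
  have "\<forall>d. below u d \<le> below u' d" using * by argo
  then show "below u d \<le> below u' d" for d by blast
  have "\<forall>d X. below u d \<le> X \<longrightarrow> 
       (\<forall>e. e \<in> fst ` set v \<longrightarrow> e < d \<longrightarrow> below u (Suc e) + (below v d - below v e) \<le> X) \<longrightarrow>
       below u' d \<le> X" using * by argo
  then show "below u' d \<le> X" if "below u d \<le> X"
     "\<And>e. e \<in> fst ` set v \<Longrightarrow> e < d \<Longrightarrow> below u (Suc e) + (below v d - below v e) \<le> X" for d X
    using that by simp
qed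

section \<open>Tableaux\<close>

text \<open>
  A row \<open>u2\<close> may stand directly below a row \<open>u1\<close>: at each time the letter of \<open>u2\<close> exists only if
  that of \<open>u1\<close> does, and is larger. For rows this says that the letters up to \<open>d\<close> of \<open>u2\<close>
  last no longer than the letters smaller than \<open>d\<close> of \<open>u1\<close>.
\<close>

definition above :: "tword \<Rightarrow> tword \<Rightarrow> bool" where
  "above u1 u2 \<longleftrightarrow> (\<forall>d. below u2 (Suc d) \<le> below u1 d)"

text \<open>Column strictness is required for all pairs of rows; by transitivity this is the same as
  requiring it for adjacent ones.\<close>

definition tableau :: "tword list \<Rightarrow> bool" where
  "tableau T \<longleftrightarrow> (\<forall>u \<in> set T. timed_row u \<and> u \<noteq> []) \<and> sorted_wrt above T"

lemma above_trans: "above u v \<Longrightarrow> above v w \<Longrightarrow> timed_row v \<Longrightarrow> above u w"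
  unfolding above_def
  by (meson below_mono le_SucI order.refl order.trans pos_nonneg timed_row_pos)

lemma tableau_Cons:
  assumes "tableau T" "timed_row u" "u \<noteq> []" "T \<noteq> [] \<Longrightarrow> above u (hd T)"
  shows "tableau (u # T)"
  using assms by (cases T) (auto simp: tableau_def intro: above_trans)

lemma above_rins:
  assumes "timed_row u1" "timed_row v" "timed_row u2" "above u1 u2"
    and r1: "rins u1 v = (v1, u1')" and r2: "rins u2 v1 = (v2, u2')"
  shows "above u1' u2'"
  unfolding above_def
proof
  fix d
  note p1 = rins_row[OF assms(1,2) r1]
  note p2 = rins_row[OF assms(3) p1(1) r2]
  have le: "below u2 (Suc e) \<le> below u1 e" for e using assms(4) by (simp add: above_def)
  show "below u2' (Suc d) \<le> below u1' d"
  proof (rule p2(8))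
    show "below u2 (Suc d) \<le> below u1' d" using le[of d] p1(7)[of d] by simp
    fix e assume "e < Suc d"
    then have "below v d - below v e \<le> below u1' d - below u1' e" by (intro p1(6)) simp
    then show "below u2 (Suc e) + (below v1 (Suc d) - below v1 e) \<le> below u1' d"
      using le[of e] p1(4)[of e] p1(5)[of d] by simp
  qed
qed

lemma above_bumped:
  assumes "timed_row u" "timed_row v" "rins u v = (v', u')"
  shows "above u' v'"
  unfolding above_def
proof
  fix d
  show "below v' (Suc d) \<le> below u' d"
    using rins_row(5)[OF assms, of d] rins_row(6)[OF assms, of 0 d] by simp
qed

lemma rins_nonempty:
  assumes "timed_row u" "timed_row v" "rins u v = (v', u')" "u \<noteq> []"
  shows "u' \<noteq> []"
proof
  assume "u' = []"
  then have "below u d \<le> 0" for d using rins_row(7)[OF assms(1-3), of d] by simp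
  moreover have "below u (Suc (fst (hd u))) > 0"
  proof (cases u)
    case (Cons x w)
    then show ?thesis using assms(1) below_nonneg[of w]
      by (auto simp: timed_row_iff pos_nonneg add_pos_nonneg)
  qed (use assms in simp)
  ultimately show False by (meson not_le)
qed

text \<open>The reading word lists the rows from bottom to top.\<close>

definition reading :: "tword list \<Rightarrow> tword" where
  "reading T = concat (rev T)"

lemma tab_insert_tableau:
  assumes "tableau T" "timed_row v"
  shows "tableau (tab_insert T v) \<and> reading T @ v \<approx>\<^sub>K reading (tab_insert T v)"
  using assms
proof (induction T arbitrary: v)
  case Nil
  then show ?case by (auto simp: tableau_def reading_def)
next
  case (Cons u us)
  obtain v' u' where r: "rins u v = (v', u')" by (cases "rins u v")
  have u: "timed_row u" "u \<noteq> []" and us: "tableau us" using Cons.prems by (auto simp: tableau_def)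
  note p = rins_row[OF u(1) Cons.prems(2) r]
  note IH = Cons.IH[OF us p(1)]
  have "tableau (u' # tab_insert us v')"
  proof (rule tableau_Cons)
    assume ne: "tab_insert us v' \<noteq> []"
    show "above u' (hd (tab_insert us v'))"
    proof (cases us)
      case Nil
      then show ?thesis using ne above_bumped[OF u(1) Cons.prems(2) r] by (auto split: if_splits)
    next
      case (Cons u2 us2)
      obtain v2 u2' where r2: "rins u2 v' = (v2, u2')" by (cases "rins u2 v'")
      have "timed_row u2" "above u u2" using Cons.prems(1) Cons by (auto simp: tableau_def)
      then show ?thesis using above_rins[OF u(1) Cons.prems(2) _ _ r r2] Cons r2 by simp
    qed
  qed (use IH p rins_nonempty[OF u(1) Cons.prems(2) r u(2)] in auto)
  moreover have "reading (u # us) @ v \<approx>\<^sub>K reading (u' # tab_insert us v')"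
  proof -
    have "reading (u # us) @ v = reading us @ (u @ v)" by (simp add: reading_def)
    also have "\<dots> \<approx>\<^sub>K reading us @ (v' @ u')" by (intro knuth_eq_append knuth_eq_refl p)
    also have "\<dots> = (reading us @ v') @ u'" by simp
    also have "\<dots> \<approx>\<^sub>K reading (tab_insert us v') @ u'"
      by (rule knuth_eq_append[OF conjunct2[OF IH] knuth_eq_refl])
    also have "\<dots> = reading (u' # tab_insert us v')" by (simp add: reading_def)
    finally show ?thesis .
  qed
  ultimately show ?case using r by simp
qed

lemma insertion_tableau_snoc:
  "insertion_tableau (w @ [x]) = tab_insert (insertion_tableau w) [x]"
  by (simp add: insertion_tableau_def)

lemma insertion_tableau_knuth_eq:
  assumes "pos w"
  shows "tableau (insertion_tableau w) \<and> w \<approx>\<^sub>K reading (insertion_tableau w)"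
  using assms
proof (induction w rule: rev_induct)
  case Nil
  then show ?case by (simp add: insertion_tableau_def tableau_def reading_def)
next
  case (snoc x w)
  let ?T = "insertion_tableau w"
  have IH: "tableau ?T" "w \<approx>\<^sub>K reading ?T" using snoc by auto
  have "timed_row [x]" using snoc.prems by (simp add: timed_row_iff)
  note step = tab_insert_tableau[OF IH(1) this]
  have "w @ [x] \<approx>\<^sub>K reading ?T @ [x]" by (rule knuth_eq_append[OF IH(2) knuth_eq_refl])
  then show ?case using step knuth_eq_trans unfolding insertion_tableau_snoc by blast
qed

section \<open>Greene's theorem for the reading word of a tableau\<close>

lemma map_eq_concatD:
  "map f X = concat L \<Longrightarrow> \<exists>Ls. X = concat Ls \<and> map (map f) Ls = L"
proof (induction L arbitrary: X)
  case (Cons l L)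
  then obtain Y Z where "X = Y @ Z" "map f Y = l" "map f Z = concat L"
    by (auto simp: map_eq_append_conv)
  moreover obtain Ls where "Z = concat Ls" "map (map f) Ls = L" using Cons.IH calculation(3) by blast
  ultimately show ?case by (intro exI[of _ "Y # Ls"]) simp
qed simp

text \<open>The first \<open>r\<close> rows, each with a colour of its own.\<close>

lemma attains_first_rows:
  assumes "tableau T" "r \<le> length T"
  shows "attains r (reading T) (\<Sum>i<r. tlen (T ! i))"
proof -
  have "\<exists>X. map fst X = reading T \<and> (\<forall>x \<in> set X. snd x \<le> k + r \<and> (snd x = 0 \<or> k < snd x)) \<and>
     sorted_wrt compat X \<and> cweight X = (\<Sum>i<r. tlen (T ! i))" for k
    using assms
  proof (induction T arbitrary: r k)
    case Nil
    then show ?case by (auto simp: reading_def)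
  next
    case (Cons u us)
    show ?case
    proof (cases r)
      case 0
      have "cweight (map (\<lambda>x. (x, 0)) w) = 0" for w by (induction w) auto
      then show ?thesis using 0
        by (intro exI[of _ "map (\<lambda>x. (x, 0)) (reading (u # us))"])
          (auto simp: comp_def sorted_wrt_map compat_def intro: sorted_wrt_mono_rel)
    next
      case (Suc r')
      have u: "timed_row u" and us: "tableau us" "r' \<le> length us"
        using Cons.prems Suc by (auto simp: tableau_def)
      obtain X where X: "map fst X = reading us" "sorted_wrt compat X" "cweight X = (\<Sum>i<r'. tlen (us ! i))"
        "\<And>x. x \<in> set X \<Longrightarrow> snd x \<le> Suc k + r' \<and> (snd x = 0 \<or> Suc k < snd x)"
        using Cons.IH[OF us, of "Suc k"] by blast
      define Y where "Y = map (\<lambda>x. (x, Suc k)) u"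
      have "cweight (map (\<lambda>x. (x, Suc k)) w) = tlen w" for w by (induction w) auto
      then have wY: "cweight Y = tlen u" by (simp add: Y_def)
      have "sorted_wrt (\<lambda>x y. fst x \<le> fst y) u" using timed_row_sorted[OF u] by (simp add: sorted_wrt_map)
      then have "sorted_wrt compat Y" unfolding Y_def sorted_wrt_map
        by (rule sorted_wrt_mono_rel[rotated]) (simp add: compat_def)
      moreover have "compat x y" if "x \<in> set X" "y \<in> set Y" for x y
        using X(4)[OF that(1)] that(2) by (auto simp: compat_def Y_def)
      ultimately have "sorted_wrt compat (X @ Y)" using X(2) by (simp add: sorted_wrt_append)
      moreover have "map fst (X @ Y) = reading (u # us)"
        using X(1) by (simp add: Y_def reading_def comp_def)
      moreover have "cweight (X @ Y) = (\<Sum>i<r. tlen ((u # us) ! i))"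
        using X(3) wY unfolding Suc sum.lessThan_Suc_shift by simp
      moreover have "snd x \<le> k + r \<and> (snd x = 0 \<or> k < snd x)" if "x \<in> set (X @ Y)" for x
        using that X(4)[of x] Suc by (auto simp: Y_def)
      ultimately show ?thesis by blast
    qed
  qed
  from this[of 0] show ?thesis by (auto simp: attains_def colouring_def)
qed

lemma below_Suc_row: "timed_row u \<Longrightarrow> (c, t) \<in> set u \<Longrightarrow> below u (Suc c) = below u c + t"
proof (induction u)
  case (Cons x u)
  show ?case
  proof (cases "x = (c, t)")
    case True
    have "below u d = 0" if "d \<le> Suc c" for d
      using Cons.prems(1) True that by (intro below_eq_0) (force simp: timed_row_iff)
    then show ?thesis using True by simp
  next
    case False
    then have "fst x < c" using Cons.prems by (force simp: timed_row_iff)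
    then show ?thesis using Cons False by (auto simp: timed_row_iff)
  qed
qed simp

lemma emeasure_Ico_finite: "emeasure lborel {a..<b::real} < \<infinity>"
  by (cases "a \<le> b") auto

text \<open>In a row every letter occupies a single interval of times, which \<open>below\<close> describes.\<close>

lemma measure_coloured:
  assumes "timed_row (map fst X)"
  defines "I \<equiv> \<lambda>x::(nat \<times> real) \<times> nat. {below (map fst X) (fst (fst x))..<below (map fst X) (Suc (fst (fst x)))}"
  shows "measure lborel (\<Union>x \<in> {x \<in> set X. snd x \<noteq> 0}. I x) = cweight X"
proof -
  let ?C = "{x \<in> set X. snd x \<noteq> 0}"
  have nn: "nonneg (map fst X)" using assms by (simp add: timed_row_pos pos_nonneg)
  have strict: "sorted_wrt (<) (map (fst \<circ> fst) X)" using assms by (simp add: timed_row_iff)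
  then have "distinct (map (fst \<circ> fst) X)" by (simp add: strict_sorted_iff)
  then have inj: "inj_on (fst \<circ> fst) (set X)" and dist: "distinct X" by (auto simp: distinct_map)
  have m: "measure lborel (I x) = snd (fst x)" if "x \<in> set X" for x
  proof -
    have "fst x \<in> set (map fst X)" using that by auto
    then have "below (map fst X) (Suc (fst (fst x))) = below (map fst X) (fst (fst x)) + snd (fst x)"
      by (intro below_Suc_row[OF assms(1)]) simp
    moreover have "0 \<le> snd (fst x)" using nn that by (auto simp: nonneg_def)
    ultimately show ?thesis by (simp add: I_def)
  qed
  have disj: "disjoint_family_on I ?C"
    unfolding disjoint_family_on_def
  proof (intro ballI impI)
    fix x y assume xy: "x \<in> ?C" "y \<in> ?C" "x \<noteq> y"
    then have "fst (fst x) \<noteq> fst (fst y)" using inj by (auto simp: inj_on_def)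
    then consider "Suc (fst (fst x)) \<le> fst (fst y)" | "Suc (fst (fst y)) \<le> fst (fst x)" by linarith
    then show "I x \<inter> I y = {}"
      by cases (use below_mono[OF nn] in \<open>force simp: I_def\<close>)+
  qed
  have "measure lborel (\<Union>x \<in> ?C. I x) = (\<Sum>x \<in> ?C. measure lborel (I x))"
    using disj using emeasure_Ico_finite
    by (intro measure_finite_Union) (auto simp: I_def less_top)
  also have "\<dots> = (\<Sum>x \<in> set X. if snd x = 0 then 0 else snd (fst x))"
    using m by (intro sum.mono_neutral_cong_left) auto
  also have "\<dots> = cweight X" unfolding cweight_def using dist by (simp add: sum_list_distinct_conv_sum_set)
  finally show ?thesis .
qed

lemma sorted_wrt_concatD:
  "sorted_wrt P (concat Ls) \<Longrightarrow> i < j \<Longrightarrow> j < length Ls \<Longrightarrow> x \<in> set (Ls ! i) \<Longrightarrow> y \<in> set (Ls ! j) \<Longrightarrow> P x y"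
proof (induction Ls arbitrary: i j)
  case (Cons L Ls)
  obtain j' where j: "j = Suc j'" using Cons.prems by (cases j) auto
  show ?case
  proof (cases i)
    case 0
    then show ?thesis using Cons.prems j by (auto simp: sorted_wrt_append) (meson nth_mem)
  next
    case (Suc i')
    then show ?thesis using Cons.prems j by (intro Cons.IH[of i' j']) (auto simp: sorted_wrt_append)
  qed
qed simp

lemma above_tlen: assumes "above u v" "timed_row u" shows "tlen v \<le> tlen u"
proof -
  obtain D where "\<forall>c \<in> fst ` set (u @ v). c < D"
    using finite_nat_set_iff_bounded[of "fst ` set (u @ v)"] by auto
  then have "below u D = tlen u" "below v (Suc D) = tlen v" by (intro below_eq_tlen; force)+
  then show ?thesis using assms(1) unfolding above_def by metis
qed

text \<open>
  At each time \<open>x\<close> the letters of a tableau form a strictly increasing column, which the reading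
  word lists from bottom to top. So the segments of one colour meet the column at most once, and
  \<open>r\<close> colours meet it in at most \<open>r\<close> letters. Integration over \<open>x\<close> gives the bound.
\<close>

lemma attains_reading_le:
  assumes T: "tableau T" and r: "r \<le> length T" and att: "attains r (reading T) m"
  shows "m \<le> (\<Sum>i<r. tlen (T ! i))"
proof -
  let ?l = "length T"
  obtain X where X: "colouring r (reading T) X" "m \<le> cweight X" using att by (auto simp: attains_def)
  obtain Ls where Ls: "X = concat Ls" "map (map fst) Ls = rev T"
    using X(1) map_eq_concatD[of fst X "rev T"] by (auto simp: colouring_def reading_def)
  define Y where "Y i = Ls ! (?l - Suc i)" for i
  have len: "length Ls = ?l" using Ls(2) by (metis length_map length_rev)
  have Y: "map fst (Y i) = T ! i" if "i < ?l" for i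
  proof -
    have "map fst (Y i) = rev T ! (?l - Suc i)" using that len unfolding Y_def Ls(2)[symmetric] by simp
    then show ?thesis using that by (simp add: rev_nth)
  qed
  have YX: "set (Y i) \<subseteq> set X" if "i < ?l" for i
    
  proof -
    have "Y i \<in> set Ls" unfolding Y_def using that len by (intro nth_mem) auto
    then show ?thesis by (auto simp: Ls(1))
  qed
  have Ycompat: "compat y x" if "i < j" "j < ?l" "x \<in> set (Y i)" "y \<in> set (Y j)" for i j x y
    using sorted_wrt_concatD[of compat Ls "?l - Suc j" "?l - Suc i" y x] X(1) that len
    by (auto simp: colouring_def Ls(1) Y_def)
  have row: "timed_row (T ! i)" if "i < ?l" for i using T that by (auto simp: tableau_def)
  have ab: "above (T ! i) (T ! j)" if "i < j" "j < ?l" for i j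
    using T that by (auto simp: tableau_def intro: sorted_wrt_nth_less)
  define I where "I i x = {below (T ! i) (fst (fst x))..<below (T ! i) (Suc (fst (fst x)))}"
    for i and x :: "(nat \<times> real) \<times> nat"
  define A where "A i = (\<Union>x \<in> {x \<in> set (Y i). snd x \<noteq> 0}. I i x)" for i
  have mA: "measure lborel (A i) = cweight (Y i)" if "i < ?l" for i
    using measure_coloured[of "Y i"] row[OF that] Y[OF that] by (simp add: A_def I_def)
  have A01: "0 \<le> t \<and> t < tlen (T ! i)" if it: "i < ?l" "t \<in> A i" for i t
  proof -
    have nn: "nonneg (T ! i)" using row[OF it(1)] by (simp add: timed_row_pos pos_nonneg)
    obtain D where "\<forall>c \<in> fst ` set (T ! i). c < D" 
      using finite_nat_set_iff_bounded[of "fst ` set (T ! i)"] by auto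
    then have "below (T ! i) (max D d) = tlen (T ! i)" for d by (intro below_eq_tlen) force
    then have "below (T ! i) d \<le> tlen (T ! i)" for d using below_mono[OF nn, of d "max D d"] by simp
    moreover obtain x where "t \<in> I i x" using it(2) unfolding A_def by blast
    ultimately show ?thesis using below_nonneg[OF nn] unfolding I_def
      by (meson atLeastLessThan_iff less_le_trans order_trans)
  qed
  have count: "(\<Sum>i<?l. indicator (A i) t) \<le> (\<Sum>i<r. indicator {0..<tlen (T ! i)} t :: real)" for t
  proof -
    define J where "J = {i. i < ?l \<and> t \<in> A i}"
    define H where "H = {i. i < r \<and> t \<in> {0..<tlen (T ! i)}}"
    have fin: "finite J" "finite H" by (auto simp: J_def H_def)
    have "\<exists>x. x \<in> set (Y i) \<and> snd x \<noteq> 0 \<and> t \<in> I i x" if "i \<in> J" for i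
      using that by (auto simp: J_def A_def)
    then obtain f where f: "\<And>i. i \<in> J \<Longrightarrow> f i \<in> set (Y i) \<and> snd (f i) \<noteq> 0 \<and> t \<in> I i (f i)" by metis
    have ne: "snd (f i) \<noteq> snd (f j)" if "i \<in> J" "j \<in> J" "i < j" for i j
    proof
      assume "snd (f i) = snd (f j)"
      then have le: "fst (fst (f j)) \<le> fst (fst (f i))"
        using Ycompat[of i j "f i" "f j"] f that by (auto simp: compat_def J_def)
      have "below (T ! j) (Suc (fst (fst (f j)))) \<le> below (T ! i) (fst (fst (f j)))"
        using ab[of i j] that by (auto simp: above_def J_def)
      also have "\<dots> \<le> below (T ! i) (fst (fst (f i)))"
        using le row[of i] that by (intro below_mono) (auto simp: J_def timed_row_pos pos_nonneg)
      finally show False using f[OF that(1)] f[OF that(2)] by (auto simp: I_def)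
    qed
    have inj: "inj_on (\<lambda>i. snd (f i)) J"
      using ne by (intro linorder_inj_onI) (auto simp: eq_commute)
    have "(\<lambda>i. snd (f i)) ` J \<subseteq> {1..r}"
      using f YX X(1) by (force simp: J_def colouring_def)
    then have Jr: "card J \<le> r" using card_inj_on_le[OF inj, of "{1..r}"] by simp
    have "card J \<le> card H"
    proof (cases "J \<subseteq> {..<r}")
      case True
      then have "J \<subseteq> H" using A01 by (auto simp: J_def H_def)
      then show ?thesis using fin by (simp add: card_mono)
    next
      case False
      then obtain i where "i \<in> J" "i \<notin> {..<r}" by blast
      then have i: "i < ?l" "t \<in> A i" "r \<le> i" by (auto simp: J_def)
      have "t \<in> {0..<tlen (T ! k)}" if "k < r" for k
        using above_tlen[OF ab[of k i] row] A01[OF i(1,2)] that i by force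
      then have "H = {..<r}" by (auto simp: H_def)
      then show ?thesis using Jr by simp
    qed
    moreover have "(\<Sum>i<?l. indicator (A i) t) = real (card J)"
      unfolding J_def by (simp add: indicator_def sum.If_cases lessThan_def Int_def)
    moreover have "(\<Sum>i<r. indicator {0..<tlen (T ! i)} t) = real (card H)"
      unfolding H_def by (simp add: indicator_def sum.If_cases lessThan_def Int_def)
    ultimately show ?thesis by simp
  qed
  have Am: "A i \<in> sets lborel" for i unfolding A_def I_def by auto
  have Afin: "emeasure lborel (A i) < \<infinity>" if "i < ?l" for i
  proof -
    have "emeasure lborel (A i) \<le> emeasure lborel {0..<tlen (T ! i)}"
      using A01[OF that] by (intro emeasure_mono) auto
    then show ?thesis using emeasure_Ico_finite by (rule le_less_trans)
  qed
  have len0: "0 \<le> tlen (T ! i)" if "i < ?l" for i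
    using row[OF that] by (simp add: tlen_nonneg timed_row_pos pos_nonneg)
  have "cweight (concat L) = (\<Sum>x\<leftarrow>L. cweight x)" for L by (induction L) auto
  then have "cweight X = (\<Sum>i<?l. cweight (Ls ! i))"
    using len by (simp add: Ls(1) sum_list_sum_nth atLeast0LessThan)
  also have "\<dots> = (\<Sum>i<?l. cweight (Y i))"
    unfolding Y_def by (rule sum.nat_diff_reindex[symmetric])
  also have "\<dots> = (\<Sum>i<?l. measure lborel (A i))" using mA by simp
  also have "\<dots> = (\<Sum>i<?l. LINT t|lborel. indicator (A i) t)" by simp
  also have "\<dots> = (LINT t|lborel. (\<Sum>i<?l. indicator (A i) t))"
    using Am Afin by (intro Bochner_Integration.integral_sum[symmetric]) auto
  also have "\<dots> \<le> (LINT t|lborel. (\<Sum>i<r. indicator {0..<tlen (T ! i)} t))"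
    using Am Afin count by (intro integral_mono Bochner_Integration.integrable_sum)
      (use emeasure_Ico_finite in auto)
  also have "\<dots> = (\<Sum>i<r. LINT t|lborel. indicator {0..<tlen (T ! i)} t)"
    by (intro Bochner_Integration.integral_sum) (use emeasure_Ico_finite in auto)
  also have "\<dots> = (\<Sum>i<r. tlen (T ! i))" using len0 r by (intro sum.cong) auto
  finally show ?thesis using X(2) by simp
qed

section \<open>Subwords and Greene invariants\<close>

text \<open>The time interval of the segment with index \<open>j\<close>.\<close>

definition seg :: "tword \<Rightarrow> nat \<Rightarrow> real set" where
  "seg w j = {tlen (take j w)..<tlen (take (Suc j) w)}"

lemma measure_seg: "nonneg w \<Longrightarrow> j < length w \<Longrightarrow> measure lebesgue (seg w j) = snd (w ! j)"
  using tlen_take_mono[of w j "Suc j"] by (simp add: seg_def tlen_take_Suc)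

lemma seg_disjoint: "nonneg w \<Longrightarrow> i \<noteq> j \<Longrightarrow> seg w i \<inter> seg w j = {}"
proof -
  assume "nonneg w" "i \<noteq> j"
  then have "tlen (take (Suc i) w) \<le> tlen (take j w) \<or> tlen (take (Suc j) w) \<le> tlen (take i w)"
    by (metis Suc_leI linorder_neqE_nat tlen_take_mono)
  then show ?thesis by (auto simp: seg_def)
qed

text \<open>The restriction of a word to a set of times, segment by segment; it may contain segments
  of duration 0.\<close>

definition restrict_word :: "tword \<Rightarrow> real set \<Rightarrow> tword" where
  "restrict_word w S = map (\<lambda>j. (fst (w ! j), measure lebesgue (S \<inter> seg w j))) [0..<length w]"

lemma nonneg_restrict: "nonneg (restrict_word w S)"
  by (auto simp: restrict_word_def nonneg_def)

lemma lmeasurable_Ico: "{a..<b::real} \<in> lmeasurable"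
  by (intro bounded_set_imp_lmeasurable bounded_subset[OF bounded_closed_interval[of a b]]) auto

lemma lebesgue_bounded_sub:
  assumes "S \<in> sets lebesgue" "S \<subseteq> {0..<L::real}"
  shows "S \<in> lmeasurable"
  using fmeasurable_Int_fmeasurable[OF lmeasurable_Ico[of 0 L] assms(1)] assms(2)
  by (simp add: Int_absorb1)

lemma measure_split:
  fixes a b :: real
  assumes "S \<in> lmeasurable" "a \<le> b"
  shows "measure lebesgue (S \<inter> {..<b}) = measure lebesgue (S \<inter> {..<a}) + measure lebesgue (S \<inter> {a..<b})"
proof -
  have *: "S \<inter> {..<b} = (S \<inter> {..<a}) \<union> (S \<inter> {a..<b})" "(S \<inter> {..<a}) \<inter> (S \<inter> {a..<b}) = {}"
    using assms(2) by auto
  have "S \<inter> {..<a} \<in> lmeasurable" "S \<inter> {a..<b} \<in> lmeasurable"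
    using assms(1) by (auto intro: fmeasurable_Int_fmeasurable)
  then show ?thesis unfolding *(1) using measure_Un3 *(2) by (metis diff_zero measure_empty)
qed

lemma tlen_take_restrict:
  assumes "nonneg w" "S \<in> sets lebesgue" "S \<subseteq> {0..<tlen w}" "j \<le> length w"
  shows "tlen (take j (restrict_word w S)) = measure lebesgue (S \<inter> {..<tlen (take j w)})"
  using assms(4)
proof (induction j)
  case 0
  have "S \<inter> {..<0} = {}" using assms(3) by auto
  then show ?case by simp
next
  case (Suc j)
  have S: "S \<in> lmeasurable" using lebesgue_bounded_sub assms by blast
  have "measure lebesgue (S \<inter> {..<tlen (take (Suc j) w)}) =
      measure lebesgue (S \<inter> {..<tlen (take j w)}) + measure lebesgue (S \<inter> seg w j)"
    unfolding seg_def using tlen_take_mono[OF assms(1)] by (intro measure_split S) simp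
  then show ?case using Suc by (simp add: restrict_word_def take_map tlen_take_Suc take_Suc_conv_app_nth)
qed

lemma tlen_restrict:
  assumes "nonneg w" "S \<in> sets lebesgue" "S \<subseteq> {0..<tlen w}"
  shows "tlen (restrict_word w S) = measure lebesgue S"
proof -
  have "S \<inter> {..<tlen w} = S" using assms(3) by auto
  then show ?thesis using tlen_take_restrict[OF assms order_refl] by (simp add: restrict_word_def)
qed

lemma tlen_filter_pos: "nonneg w \<Longrightarrow> tlen (filter (\<lambda>x. 0 < snd x) w) = tlen w"
  by (induction w) auto

lemma letter_at_filter_pos:
  "nonneg w \<Longrightarrow> 0 \<le> t \<Longrightarrow> letter_at (filter (\<lambda>x. 0 < snd x) w) t = letter_at w t"
proof (induction w arbitrary: t)
  case (Cons x w)
  then show ?case by (cases x) auto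
qed simp

text \<open>The measure of the part of \<open>S\<close> before \<open>b\<close> is continuous in \<open>b\<close>, so it assumes the value \<open>t\<close> at
  a greatest time.\<close>

lemma greatest_time:
  fixes S :: "real set"
  assumes S: "S \<in> sets lebesgue" "S \<subseteq> {0..<L}" and t: "0 \<le> t" "t < measure lebesgue S"
  obtains b where "(GREATEST b. 0 \<le> b \<and> b < L \<and> measure lebesgue (S \<inter> {0..<b}) = t) = b"
    "0 \<le> b" "b < L" "measure lebesgue (S \<inter> {..<b}) = t"
    "\<And>x. b < x \<Longrightarrow> t < measure lebesgue (S \<inter> {..<x})"
proof -
  let ?F = "\<lambda>b. measure lebesgue (S \<inter> {..<b})"
  have Sm: "S \<in> lmeasurable" using lebesgue_bounded_sub assms by blast
  have eq: "S \<inter> {0..<b} = S \<inter> {..<b}" for b using S(2) by auto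
  have step: "?F b = ?F a + measure lebesgue (S \<inter> {a..<b})" if "a \<le> b" for a b
    using Sm that by (rule measure_split)
  have mono: "?F a \<le> ?F b" if "a \<le> b" for a b using step[OF that] by simp
  have lip: "?F b \<le> ?F a + (b - a)" if "a \<le> b" for a b
  proof -
    have "measure lebesgue (S \<inter> {a..<b}) \<le> measure lebesgue {a..<b}"
      using S(1) by (intro measure_mono_fmeasurable lmeasurable_Ico) auto
    then show ?thesis using step[OF that] that by simp
  qed
  have "1-lipschitz_on UNIV ?F"
  proof (rule lipschitz_onI)
    fix a b :: real
    show "dist (?F a) (?F b) \<le> 1 * dist a b"
      using mono[of a b] lip[of a b] mono[of b a] lip[of b a] by (cases "a \<le> b") (auto simp: dist_real_def)
  qed simp
  then have cont: "continuous_on UNIV ?F" by (rule lipschitz_on_continuous_on)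
  have L: "?F L = measure lebesgue S" using S(2) by (intro arg_cong[of _ _ "measure lebesgue"]) auto
  have F0: "?F b = 0" if "b \<le> 0" for b
  proof -
    have "S \<inter> {..<b} = {}" using S(2) that by auto
    then show ?thesis by simp
  qed
  have "0 \<le> L" using L F0[of L] t by linarith
  let ?B = "{0..L} \<inter> ?F -` {t}"
  have "\<exists>b. 0 \<le> b \<and> b \<le> L \<and> ?F b = t"
    using F0[of 0] L t \<open>0 \<le> L\<close> cont by (intro IVT') (auto intro: continuous_on_subset)
  then have "?B \<noteq> {}" by auto
  moreover have "compact ?B"
    using continuous_closed_vimage[of "{t}" ?F] cont by (intro compact_Int_closed) (auto simp: continuous_on_eq_continuous_at)
  ultimately obtain b where b: "b \<in> ?B" "\<And>x. x \<in> ?B \<Longrightarrow> x \<le> b"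
    using compact_attains_sup by metis
  have "b \<noteq> L" using b(1) L t by auto
  then have bL: "0 \<le> b" "b < L" "?F b = t" using b(1) by auto
  have "(GREATEST b. 0 \<le> b \<and> b < L \<and> measure lebesgue (S \<inter> {0..<b}) = t) = b"
    unfolding eq using bL b(2) by (intro Greatest_equality) auto
  moreover have "t < ?F x" if "b < x" for x
  proof (cases "x \<le> L")
    case True
    have "?F x \<noteq> t" using b(2)[of x] that True bL by auto
    then show ?thesis using mono[of b x] that bL by simp
  next
    case False
    then show ?thesis using mono[of L x] L t by simp
  qed
  ultimately show ?thesis using that bL by blast
qed

lemma subword_eq:
  assumes w: "nonneg w" and S: "S \<in> sets lebesgue" "S \<subseteq> {0..<tlen w}"
  shows "subword w S = reduce (filter (\<lambda>x. 0 < snd x) (restrict_word w S))" (is "_ = reduce ?v")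
  unfolding subword_def
proof (rule tword_of_eqI)
  let ?u = "restrict_word w S"
  have "pos ?v" by (auto simp: pos_def)
  then show "reduced (reduce ?v)" by (rule reduced_reduce)
  show "tlen (reduce ?v) = measure lebesgue S"
    using tlen_restrict[OF assms] by (simp add: tlen_filter_pos nonneg_restrict)
  fix t assume t: "0 \<le> t" "t < measure lebesgue S"
  obtain b where b: "(GREATEST b. 0 \<le> b \<and> b < tlen w \<and> measure lebesgue (S \<inter> {0..<b}) = t) = b"
    "0 \<le> b" "b < tlen w" "measure lebesgue (S \<inter> {..<b}) = t"
    "\<And>x. b < x \<Longrightarrow> t < measure lebesgue (S \<inter> {..<x})"
    using greatest_time[OF S t] by blast
  obtain j where j: "j < length w" "tlen (take j w) \<le> b" "b < tlen (take (Suc j) w)"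
    using obtain_segment[OF w b(2,3)] by blast
  have Sm: "S \<in> lmeasurable" using lebesgue_bounded_sub S by blast
  have "letter_at ?u t = fst (?u ! j)"
  proof (rule letter_at_nth)
    show "nonneg ?u" by (rule nonneg_restrict)
    show "j < length ?u" using j by (simp add: restrict_word_def)
    have "measure lebesgue (S \<inter> {..<tlen (take j w)}) \<le> measure lebesgue (S \<inter> {..<b})"
      using Sm j(2) by (intro measure_mono_fmeasurable fmeasurable_Int_fmeasurable) auto
    then show "tlen (take j ?u) \<le> t" using tlen_take_restrict[OF assms, of j] j b(4) by simp
    show "t < tlen (take (Suc j) ?u)"
      using tlen_take_restrict[OF assms, of "Suc j"] j b(5) by simp
  qed
  also have "\<dots> = letter_at w b" using j letter_at_nth[OF w j] by (simp add: restrict_word_def)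
  finally show "letter_at (reduce ?v) t =
      letter_at w (GREATEST b. 0 \<le> b \<and> b < tlen w \<and> measure lebesgue (S \<inter> {0..<b}) = t)"
    using t nonneg_restrict pos_nonneg[OF \<open>pos ?v\<close>] 
    by (simp add: b(1) letter_at_reduce letter_at_filter_pos)
qed

lemma sorted_wrt_strict_sorted_iff:
  fixes xs :: "nat list"
  assumes "sorted_wrt (<) xs"
  shows "sorted_wrt R xs \<longleftrightarrow> (\<forall>i \<in> set xs. \<forall>j \<in> set xs. i < j \<longrightarrow> R i j)"
  using assms by (induction xs) force+

text \<open>A subword is a row when the letters that it uses for a positive time increase weakly.\<close>

lemma timed_row_subword_iff:
  assumes w: "nonneg w" and S: "S \<in> sets lebesgue" "S \<subseteq> {0..<tlen w}"
  shows "timed_row (subword w S) \<longleftrightarrow>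
    (\<forall>i j. i < j \<longrightarrow> j < length w \<longrightarrow> 0 < measure lebesgue (S \<inter> seg w i) \<longrightarrow>
       0 < measure lebesgue (S \<inter> seg w j) \<longrightarrow> fst (w ! i) \<le> fst (w ! j))"
proof -
  let ?v = "filter (\<lambda>x. 0 < snd x) (restrict_word w S)"
  let ?I = "filter (\<lambda>j. 0 < measure lebesgue (S \<inter> seg w j)) [0..<length w]"
  have "pos ?v" by (auto simp: pos_def)
  then have "timed_row (subword w S) \<longleftrightarrow> sorted (map fst ?v)"
    unfolding subword_eq[OF assms] by (rule timed_row_reduce_iff)
  also have "map fst ?v = map (\<lambda>j. fst (w ! j)) ?I"
    by (simp add: restrict_word_def filter_map comp_def)
  also have "sorted \<dots> \<longleftrightarrow> (\<forall>i \<in> set ?I. \<forall>j \<in> set ?I. i < j \<longrightarrow> fst (w ! i) \<le> fst (w ! j))"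
    unfolding sorted_wrt_map by (intro sorted_wrt_strict_sorted_iff sorted_wrt_filter) simp
  finally show ?thesis by auto
qed

lemma time_sample_sets:
  assumes "time_sample w S" shows "S \<in> sets lebesgue" "S \<subseteq> {0..<tlen w}"
proof -
  obtain ps where ps: "\<And>a b. (a, b) \<in> set ps \<Longrightarrow> 0 \<le> a \<and> b \<le> tlen w" "S = (\<Union>(a, b) \<in> set ps. {a..<b})"
    using assms unfolding time_sample_def by fast
  show "S \<subseteq> {0..<tlen w}" using ps by fastforce
  show "S \<in> sets lebesgue" unfolding ps(2) by (intro sets.finite_UN) auto
qed

lemma measure_eq_sum_seg:
  assumes "nonneg w" "S \<in> sets lebesgue" "S \<subseteq> {0..<tlen w}"
  shows "measure lebesgue S = (\<Sum>j<length w. measure lebesgue (S \<inter> seg w j))"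
  using tlen_restrict[OF assms]
  by (simp add: restrict_word_def tlen_def comp_def sum_list_sum_nth atLeast0LessThan)

lemma cweight_eq_sum: "cweight X = (\<Sum>j<length X. if snd (X ! j) = 0 then 0 else snd (fst (X ! j)))"
  by (simp add: cweight_def sum_list_sum_nth atLeast0LessThan)

text \<open>Every segment that is met in positive measure gets the colour of one of the samples meeting it.\<close>

lemma samples_attain:
  assumes w: "nonneg w" 
    and S: "\<And>i. i \<in> {1..r} \<Longrightarrow> time_sample w (S i) \<and> timed_row (subword w (S i))"
    and disj: "disjoint_family_on S {1..r}"
  shows "attains r w (\<Sum>i = 1..r. measure lebesgue (S i))"
proof -
  let ?m = "\<lambda>i j. measure lebesgue (S i \<inter> seg w j)"
  note sets = time_sample_sets[OF conjunct1[OF S]]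
  define k where "k j = (if \<exists>i \<in> {1..r}. 0 < ?m i j then SOME i. i \<in> {1..r} \<and> 0 < ?m i j else 0)" for j
  have k: "k j \<in> {1..r} \<and> 0 < ?m (k j) j" if "k j \<noteq> 0" for j
  proof -
    have "\<exists>i. i \<in> {1..r} \<and> 0 < ?m i j" using that unfolding k_def by metis
    then show ?thesis unfolding k_def using someI_ex[of "\<lambda>i. i \<in> {1..r} \<and> 0 < ?m i j"] by (simp add: Bex_def)
  qed
  have k0: "?m i j = 0" if "k j = 0" "i \<in> {1..r}" for i j
  proof (rule ccontr)
    assume "?m i j \<noteq> 0"
    then have pos: "i \<in> {1..r} \<and> 0 < ?m i j" using that by (simp add: zero_less_measure_iff)
    then have "k j = (SOME i. i \<in> {1..r} \<and> 0 < ?m i j)" unfolding k_def by auto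
    then have "k j \<in> {1..r}" using someI[of "\<lambda>i. i \<in> {1..r} \<and> 0 < ?m i j", OF pos] by simp
    then show False using that by simp
  qed
  define X where "X = map (\<lambda>j. (w ! j, k j)) [0..<length w]"
  have "sorted_wrt compat X"
    unfolding sorted_wrt_iff_nth_less compat_def
  proof (intro allI impI)
    fix i j assume *: "i < j" "j < length X" "snd (X ! i) = snd (X ! j)" "snd (X ! i) \<noteq> 0"
    then have ij: "j < length w" "k i = k j" "k i \<noteq> 0" by (auto simp: X_def)
    then have kr: "k j \<in> {1..r}" using k[of j] by simp
    have "fst (w ! i) \<le> fst (w ! j)"
      using conjunct2[OF S[OF kr]] k[of i] k[of j] ij *(1)
      unfolding timed_row_subword_iff[OF w sets[OF kr]] by auto
    then show "fst (fst (X ! i)) \<le> fst (fst (X ! j))" using * by (simp add: X_def)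
  qed
  moreover have "map fst X = w" unfolding X_def by (simp add: comp_def map_nth)
  moreover have "k j \<le> r" for j using k[of j] by (cases "k j = 0") auto
  ultimately have "colouring r w X" by (auto simp: colouring_def X_def)
  moreover have "(\<Sum>i = 1..r. measure lebesgue (S i)) \<le> cweight X"
  proof -
    have "(\<Sum>i = 1..r. measure lebesgue (S i)) = (\<Sum>i = 1..r. \<Sum>j<length w. ?m i j)"
      using measure_eq_sum_seg[OF w sets] by (intro sum.cong) auto
    also have "\<dots> = (\<Sum>j<length w. \<Sum>i = 1..r. ?m i j)" by (rule sum.swap)
    also have "\<dots> \<le> (\<Sum>j<length w. if k j = 0 then 0 else snd (w ! j))"
    proof (rule sum_mono)
      fix j assume j: "j \<in> {..<length w}"
      show "(\<Sum>i = 1..r. ?m i j) \<le> (if k j = 0 then 0 else snd (w ! j))"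
      proof (cases "k j = 0")
        case False
        have fin: "seg w j \<in> lmeasurable" unfolding seg_def by (rule lmeasurable_Ico)
        then have fin': "S i \<inter> seg w j \<in> lmeasurable" if "i \<in> {1..r}" for i
          using fmeasurable_Int_fmeasurable[OF fin sets(1)[OF that]] by (simp add: Int_commute)
        have "pairwise (\<lambda>i i'. disjnt (S i \<inter> seg w j) (S i' \<inter> seg w j)) {1..r}"
          using disj unfolding pairwise_def disjnt_def disjoint_family_on_def by blast
        then have "(\<Sum>i = 1..r. ?m i j) = measure lebesgue (\<Union>i\<in>{1..r}. S i \<inter> seg w j)"
          using fin' by (intro measure_UNION'[symmetric]) auto
        also have "\<dots> \<le> measure lebesgue (seg w j)"
          using fin fmeasurableD[OF fin'] by (intro measure_mono_fmeasurable sets.finite_UN) auto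
        finally show ?thesis using measure_seg[OF w] j False by simp
      qed (simp add: k0)
    qed
    also have "\<dots> = cweight X" unfolding cweight_eq_sum by (intro sum.cong) (auto simp: X_def)
    finally show ?thesis .
  qed
  ultimately show ?thesis by (auto simp: attains_def)
qed

lemma sorted_wrt_snoc2:
  fixes a b :: "'a::order"
  shows "sorted_wrt (<) xs \<Longrightarrow> (\<And>x. x \<in> set xs \<Longrightarrow> x < a) \<Longrightarrow> a < b \<Longrightarrow> sorted_wrt (<) (xs @ [a, b])"
  using less_trans by (fastforce simp: sorted_wrt_append)

text \<open>Adjacent segments are merged, since the intervals of a time sample may not touch.\<close>

lemma Union_seg_time_sample:
  assumes w: "pos w"
  shows "time_sample w (\<Union>j \<in> {j. j < length w \<and> Q j}. seg w j)"
proof -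
  let ?fl = "\<lambda>ps :: (real \<times> real) list. concat (map (\<lambda>(a, b). [a, b]) ps)"
  have "\<exists>ps. sorted_wrt (<) (?fl ps) \<and> (\<forall>(a, b) \<in> set ps. 0 \<le> a \<and> b \<le> tlen (take m w)) \<and>
      (\<Union>j \<in> {j. j < m \<and> Q j}. seg w j) = (\<Union>(a, b) \<in> set ps. {a..<b})" if "m \<le> length w" for m
    using that
  proof (induction m)
    case 0
    then show ?case by (intro exI[of _ "[]"]) simp
  next
    case (Suc m)
    then obtain ps where ps: "sorted_wrt (<) (?fl ps)"
        "\<forall>(a, b) \<in> set ps. 0 \<le> a \<and> b \<le> tlen (take m w)"
        "(\<Union>j \<in> {j. j < m \<and> Q j}. seg w j) = (\<Union>(a, b) \<in> set ps. {a..<b})"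
      by (elim meta_impE exE conjE) simp_all
    let ?a = "tlen (take m w)" and ?b = "tlen (take (Suc m) w)"
    have ab: "0 \<le> ?a" "?a < ?b"
      using w Suc.prems by (auto simp: tlen_nonneg nonneg_take pos_nonneg tlen_take_Suc pos_def)
    show ?case
    proof (cases "Q m")
      case False
      then have "{j. j < Suc m \<and> Q j} = {j. j < m \<and> Q j}" by (auto simp: less_Suc_eq)
      then have "(\<Union>j \<in> {j. j < Suc m \<and> Q j}. seg w j) = (\<Union>(a, b) \<in> set ps. {a..<b})"
        using ps(3) by simp
      moreover have "\<forall>(a, b) \<in> set ps. 0 \<le> a \<and> b \<le> ?b" using ps(2) ab by auto
      ultimately show ?thesis using ps(1) by blast
    next
      case True
      then have "{j. j < Suc m \<and> Q j} = insert m {j. j < m \<and> Q j}" by (auto simp: less_Suc_eq)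
      then have U: "(\<Union>j \<in> {j. j < Suc m \<and> Q j}. seg w j) = {?a..<?b} \<union> (\<Union>(a, b) \<in> set ps. {a..<b})"
        using ps(3) by (simp add: seg_def)
      have le: "x \<le> ?a" if x: "x \<in> set (?fl ps)" for x
      proof -
        obtain a b where "(a, b) \<in> set ps" "x = a \<or> x = b" using x by auto
        moreover from this(1) obtain qs rs where "ps = qs @ (a, b) # rs" by (meson split_list)
        then have "a < b" using ps(1) by (simp add: sorted_wrt_append)
        ultimately show ?thesis using ps(2) by auto
      qed
      show ?thesis
      proof (cases "?a \<in> set (?fl ps)")
        case False
        then have "x < ?a" if "x \<in> set (?fl ps)" for x using le[OF that] that by (metis order_le_less)
        then have "sorted_wrt (<) (?fl (ps @ [(?a, ?b)]))"
          using sorted_wrt_snoc2[OF ps(1) _ ab(2)] by simp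
        then show ?thesis using ps(2) U ab by (intro exI[of _ "ps @ [(?a, ?b)]"]) fastforce
      next
        case True
        \<comment> \<open>The new interval touches the last one and has to be merged with it.\<close>
        then obtain qs a b where q: "ps = qs @ [(a, b)]" by (cases ps rule: rev_cases) auto
        have srt: "sorted_wrt (<) (?fl qs)" "\<And>x. x \<in> set (?fl qs) \<Longrightarrow> x < a" "a < b"
          using ps(1) unfolding q by (auto simp: sorted_wrt_append)
        have "b \<le> ?a" using ps(2) q by auto
        then have "b = ?a" using True srt q by fastforce
        then have eq: "{?a..<?b} \<union> {a..<b} = {a..<?b}" using srt ab by auto
        have "sorted_wrt (<) (?fl (qs @ [(a, ?b)]))"
          using sorted_wrt_snoc2[OF srt(1,2)] srt(3) ab \<open>b = ?a\<close> by simp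
        moreover have "(\<Union>j \<in> {j. j < Suc m \<and> Q j}. seg w j) = (\<Union>(a, b) \<in> set (qs @ [(a, ?b)]). {a..<b})"
          unfolding U q using eq by auto
        moreover have "\<forall>(a, b) \<in> set (qs @ [(a, ?b)]). 0 \<le> a \<and> b \<le> ?b"
          using ps(2) ab unfolding q by fastforce
        ultimately show ?thesis by blast
      qed
    qed
  qed
  from this[of "length w"] show ?thesis by (simp add: time_sample_def)
qed

lemma attains_samples:
  assumes w: "pos w" and att: "attains r w m"
  obtains S where "\<And>i. time_sample w (S i)" "\<And>i. i \<in> {1..r} \<Longrightarrow> timed_row (subword w (S i))"
    "disjoint_family_on S {1..r}" "m \<le> (\<Sum>i = 1..r. measure lebesgue (S i))"
proof -
  have nn: "nonneg w" using w by (rule pos_nonneg)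
  obtain X where X: "map fst X = w" "\<And>x. x \<in> set X \<Longrightarrow> snd x \<le> r" "sorted_wrt compat X" "m \<le> cweight X"
    using att by (auto simp: attains_def colouring_def)
  have len: "length X = length w" using X(1) by auto
  have Xw: "fst (X ! j) = w ! j" if "j < length w" for j
    using that len nth_map[of j X fst] X(1) by simp
  define S where "S i = (\<Union>j \<in> {j. j < length w \<and> snd (X ! j) = i}. seg w j)" for i
  have S: "time_sample w (S i)" for i unfolding S_def by (rule Union_seg_time_sample[OF w])
  have cut: "S i \<inter> seg w j = (if snd (X ! j) = i then seg w j else {})" if "j < length w" for i j
  proof (cases "snd (X ! j) = i")
    case False
    then have "seg w l \<inter> seg w j = {}" if "snd (X ! l) = i" for l
      using that by (intro seg_disjoint[OF nn]) auto
    then show ?thesis using False by (auto simp: S_def)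
  qed (use that in \<open>auto simp: S_def\<close>)
  have m: "measure lebesgue (S i \<inter> seg w j) = (if snd (X ! j) = i then snd (w ! j) else 0)" if "j < length w" for i j
    using cut[OF that] measure_seg[OF nn that] by simp
  have "timed_row (subword w (S i))" if "i \<in> {1..r}" for i
    unfolding timed_row_subword_iff[OF nn time_sample_sets[OF S]]
  proof (intro allI impI)
    fix j l assume *: "j < l" "l < length w" "0 < measure lebesgue (S i \<inter> seg w j)" "0 < measure lebesgue (S i \<inter> seg w l)"
    then have "snd (X ! j) = i" "snd (X ! l) = i" using m by (auto split: if_splits)
    moreover have "compat (X ! j) (X ! l)" using X(3) * len by (simp add: sorted_wrt_iff_nth_less)
    ultimately have "fst (fst (X ! j)) \<le> fst (fst (X ! l))" using that by (simp add: compat_def)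
    then show "fst (w ! j) \<le> fst (w ! l)" using * Xw by simp
  qed
  moreover have "disjoint_family_on S {1..r}"
    unfolding disjoint_family_on_def
  proof (intro ballI impI)
    fix i l :: nat assume "i \<noteq> l"
    then have "seg w j \<inter> seg w j' = {}" if "snd (X ! j) = i" "snd (X ! j') = l" for j j'
      using that by (intro seg_disjoint[OF nn]) auto
    then show "S i \<inter> S l = {}" unfolding S_def by blast
  qed
  moreover have "cweight X = (\<Sum>i = 1..r. measure lebesgue (S i))"
  proof -
    have "(\<Sum>i = 1..r. measure lebesgue (S i)) = (\<Sum>i = 1..r. \<Sum>j<length w. measure lebesgue (S i \<inter> seg w j))"
      using measure_eq_sum_seg[OF nn time_sample_sets[OF S]] by simp
    also have "\<dots> = (\<Sum>j<length w. \<Sum>i = 1..r. measure lebesgue (S i \<inter> seg w j))" by (rule sum.swap)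
    also have "\<dots> = (\<Sum>j<length w. if snd (X ! j) = 0 then 0 else snd (fst (X ! j)))"
    proof (rule sum.cong)
      fix j assume "j \<in> {..<length w}"
      then have j: "j < length w" "snd (X ! j) \<le> r" "fst (X ! j) = w ! j"
        using X(2)[of "X ! j"] len Xw by auto
      show "(\<Sum>i = 1..r. measure lebesgue (S i \<inter> seg w j)) = (if snd (X ! j) = 0 then 0 else snd (fst (X ! j)))"
        using j by (simp add: m sum.delta')
    qed simp
    finally show ?thesis by (simp add: cweight_eq_sum len)
  qed
  ultimately show ?thesis using that[of S] S X(4) by simp
qed

theorem theorem3p7p1:
  fixes n :: nat and w :: tword and lam :: "real list"
  assumes "1 \<le> n"
    and "w \<in> timed_words n"
    and "tab_shape (insertion_tableau w) = lam"
  shows "\<forall>r \<in> {1..length lam}. greene r w = (\<Sum>i = 1..r. lam ! (i - 1))"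
proof
  fix r assume r: "r \<in> {1..length lam}"
  let ?T = "insertion_tableau w"
  have w: "pos w" using assms(2) by (simp add: timed_words_def reduced_iff)
  note T = insertion_tableau_knuth_eq[OF w]
  have "filter (\<lambda>u. u \<noteq> []) ?T = ?T" using T by (auto simp: tableau_def)
  then have lam: "lam = map tlen ?T" using assms(3) by (simp add: tab_shape_def)
  then have rT: "r \<le> length ?T" using r by simp
  have sum: "(\<Sum>i = 1..r. lam ! (i - 1)) = (\<Sum>i<r. tlen (?T ! i))"
    using rT by (simp add: lam sum.atLeast1_atMost_eq)
  have att: "attains r w m \<longleftrightarrow> attains r (reading ?T) m" for m using T knuth_eq_attains by blast
  have "attains r w (\<Sum>i = 1..r. lam ! (i - 1))"
    unfolding att sum using T rT by (intro attains_first_rows) auto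
  then obtain S where S: "\<And>i. time_sample w (S i)" "\<And>i. i \<in> {1..r} \<Longrightarrow> timed_row (subword w (S i))"
    "disjoint_family_on S {1..r}" "(\<Sum>i = 1..r. lam ! (i - 1)) \<le> (\<Sum>i = 1..r. measure lebesgue (S i))"
    using attains_samples[OF w] by metis
  have le: "(\<Sum>i = 1..r. measure lebesgue (S' i)) \<le> (\<Sum>i = 1..r. lam ! (i - 1))"
    if "\<forall>i \<in> {1..r}. time_sample w (S' i) \<and> timed_row (subword w (S' i))" "disjoint_family_on S' {1..r}"
    for S' :: "nat \<Rightarrow> real set"
    unfolding sum
  proof (rule attains_reading_le)
    show "attains r (reading ?T) (\<Sum>i = 1..r. measure lebesgue (S' i))"
      using samples_attain[OF pos_nonneg[OF w], of r S'] that att by blast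
  qed (use T rT in auto)
  have eq: "(\<Sum>i = 1..r. lam ! (i - 1)) = (\<Sum>i = 1..r. measure lebesgue (S i))"
    using S le[of S] by (intro antisym) auto
  show "greene r w = (\<Sum>i = 1..r. lam ! (i - 1))"
    unfolding greene_def
  proof (rule cSup_eq_maximum)
    show "(\<Sum>i = 1..r. lam ! (i - 1)) \<in> {\<Sum>i = 1..r. measure lebesgue (S i) |S.
        (\<forall>i\<in>{1..r}. time_sample w (S i) \<and> timed_row (subword w (S i))) \<and> disjoint_family_on S {1..r}}"
      using S eq by blast
  qed (use le in blast)
qed

end
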